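(* There exists a rate $I_{\mathrm{macro}}:\mathbb R^3\to[0,\infty]$ such that $u$ satisfies a large deviation principle with rate $I_{\mathrm{macro}}$ in the macroscopic scale. Moreover, this rate admits the explicit expression \[ I_{\mathrm{macro}}(x,y,\phi)=\begin{cases}\frac{|\phi|^2}{2}&\text{for }(x,y)=0,\\ \infty&\text{else.}\end{cases} \] There exists a rate $I_{\mathrm{meso}}:\mathbb R^3\to[0,\infty]$ such that $u$ satisfies a large deviation principle with rate $I_{\mathrm{meso}}$ in the mesoscopic scale. Moreover, for $\check p=(\check x,\check y,\check\phi)$, $I_{\mathrm{meso}}(\check p)$ is finite if and only if $|(\check x,\check y)|<1$ or $\check p=(1,0,0)$.
   Context: Let $W$ be a one-dimensional standard Brownian motion and let $p_t=(x_t,y_t,\phi_t)$ solve $\mathrm dx_t=\cos(\phi_t)\,\mathrm dt$, $\mathrm dy_t=\sin(\phi_t)\,\mathrm dt$, $\mathrm d\phi_t=\mathrm dW_t$ with $p_0=0$. For $t>0$, $u_t(0,\cdot)$ denotes the density of $p_t$, identified with the corresponding probability measure on $\mathbb R^3$. Let $I:\mathbb R^3\to[0,\infty]$ be lower semicontinuous, and for each $t>0$ let $\check p_t:\mathbb R^3\to\mathbb R^3$ be a change of scale. One says that $(u_t)_{t>0}$ satisfies a large deviation principle with rate function $I$ in the scale $\check p=\check p_t(p)$ if for all $U\subset F\subset\mathbb R^3$ with $U$ open and $F$ closed, \[ -\inf_{\check p\in U}I(\check p)\le\liminf_{t\to0}t\log u_t(0,\check p_t^{-1}U)\le\limsup_{t\to0}t\log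 u_t(0,\check p_t^{-1}F)\le-\inf_{\check p\in F}I(\check p). \] The macroscopic scale is $\check p_t(x,y,\phi)=(x,y,\phi)$; the mesoscopic scale is $\check p_t(x,y,\phi)=(x/t,y/t,\phi)$. $|\cdot|$ is the Euclidean norm. *)

theory Defs
  imports "HOL-Probability.Probability"
begin

locale standard_brownian_motion = prob_space M for M :: "'a measure" +
  fixes W :: "real \<Rightarrow> 'a \<Rightarrow> real"
  assumes start: "AE \<omega> in M. W 0 \<omega> = 0"
    and random_variable_W: "\<And>t. 0 \<le> t \<Longrightarrow> random_variable borel (W t)"
    and indep_increments: "\<And>(\<tau> :: nat \<Rightarrow> real) n. 0 \<le> \<tau> 0 \<Longrightarrow> mono \<tau> \<Longrightarrow>
      indep_vars (\<lambda>_. borel) (\<lambda>i \<omega>. W (\<tau> (Suc i)) \<omega> - W (\<tau> i) \<omega>) {..<n}"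
    and normal_increments: "\<And>s t. 0 \<le> s \<Longrightarrow> s < t \<Longrightarrow>
      distributed M lborel (\<lambda>\<omega>. W t \<omega> - W s \<omega>) (normal_density 0 (sqrt (t - s)))"
    and continuous_paths: "AE \<omega> in M. continuous_on {0..} (\<lambda>t. W t \<omega>)"

type_synonym R3 = "real \<times> real \<times> real"

text \<open>
  The equations \<open>dx = cos \<phi> dt\<close>, \<open>dy = sin \<phi> dt\<close>, \<open>d\<phi> = dW\<close> with \<open>p 0 = 0\<close>, in integrated form.
  The noise is additive, so the equations are meaningful path by path.
\<close>

definition solves_sde ::
  "'a measure \<Rightarrow> (real \<Rightarrow> 'a \<Rightarrow> real) \<Rightarrow> (real \<Rightarrow> 'a \<Rightarrow> R3) \<Rightarrow> bool" where
  "solves_sde M W p \<longleftrightarrow>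
    (\<forall>t\<ge>0. p t \<in> borel_measurable M) \<and>
    (AE \<omega> in M. p 0 \<omega> = (0, 0, 0) \<and>
      (\<forall>t\<ge>0. case p t \<omega> of (x, y, \<phi>) \<Rightarrow>
        ((\<lambda>s. cos (snd (snd (p s \<omega>)))) has_integral x) {0..t} \<and>
        ((\<lambda>s. sin (snd (snd (p s \<omega>)))) has_integral y) {0..t} \<and>
        \<phi> = W t \<omega> - W 0 \<omega>))"

definition lower_semicontinuous :: "('b::topological_space \<Rightarrow> ennreal) \<Rightarrow> bool" where
  "lower_semicontinuous I \<longleftrightarrow> (\<forall>c. open {x. c < I x})"

text \<open>The library's real logarithm has \<open>ln 0 = 0\<close>; large deviations need \<open>log 0 = -\<infinity>\<close>.\<close>

definition log_prob :: "real \<Rightarrow> ereal" where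
  "log_prob r = (if r = 0 then -\<infinity> else ereal (ln r))"

text \<open>
  \<open>\<mu> t\<close> plays the role of the measure with density \<open>u\<^sub>t(0, \<cdot>)\<close>.  The infima are
  taken in \<open>[0, \<infinity>]\<close>, where the infimum over the empty set is \<open>\<infinity>\<close>.
\<close>

definition large_deviation_principle ::
  "(real \<Rightarrow> R3 measure) \<Rightarrow> (real \<Rightarrow> R3 \<Rightarrow> R3) \<Rightarrow> (R3 \<Rightarrow> ennreal) \<Rightarrow> bool" where
  "large_deviation_principle \<mu> sc I \<longleftrightarrow>
    lower_semicontinuous I \<and>
    (\<forall>U F. open U \<longrightarrow> closed F \<longrightarrow> U \<subseteq> F \<longrightarrow>
      - enn2ereal (INF q\<in>U. I q)
        \<le> Liminf (at_right 0) (\<lambda>t. ereal t * log_prob (measure (\<mu> t) (sc t -` U))) \<and>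
      Liminf (at_right 0) (\<lambda>t. ereal t * log_prob (measure (\<mu> t) (sc t -` U)))
        \<le> Limsup (at_right 0) (\<lambda>t. ereal t * log_prob (measure (\<mu> t) (sc t -` F))) \<and>
      Limsup (at_right 0) (\<lambda>t. ereal t * log_prob (measure (\<mu> t) (sc t -` F)))
        \<le> - enn2ereal (INF q\<in>F. I q))"

definition macroscopic_scale :: "real \<Rightarrow> R3 \<Rightarrow> R3" where
  "macroscopic_scale t = (\<lambda>(x, y, \<phi>). (x, y, \<phi>))"

definition mesoscopic_scale :: "real \<Rightarrow> R3 \<Rightarrow> R3" where
  "mesoscopic_scale t = (\<lambda>(x, y, \<phi>). (x / t, y / t, \<phi>))"

end

theory Submission
  imports Defs
begin

text \<open>
  In the mesoscopic scale, \<open>p t\<close> is the image of the path \<open>\<phi>\<close> on \<open>[0, t]\<close>, run at unit time, under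
  \<open>\<phi> \<mapsto> (\<integral> cos \<phi>, \<integral> sin \<phi>, \<phi> 1)\<close>. Sampling \<open>\<phi>\<close> at \<open>n\<close> equidistant times gives independent Gaussian
  increments, whose deviations are governed by the energy \<open>n / 2 * \<Sum> a\<^sub>i\<^sup>2\<close>. The error of the sampling
  exceeds \<open>\<delta>\<close> with probability at most \<open>2 exp (- n \<delta>\<^sup>2 / (2 t))\<close>, which is negligible for
  large \<open>n\<close>, so on small balls the upper and the lower exponential rate agree. The common rate is
  automatically lower semicontinuous, and exponential tightness upgrades the local estimates to the
  full principle.

  The mesoscopic rate is finite iff the point is a limit of sampled paths of bounded energy. Inside the
  unit disc such paths are obtained by turning twice around the circle with a stop in each turn. On the
  unit circle, bounded energy forces the angle to stay near its initial value \<open>0\<close>.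
  In the macroscopic scale \<open>\<bar>x\<bar>, \<bar>y\<bar> \<le> t\<close>, and only the Gaussian \<open>\<phi> t\<close> matters.
\<close>

section \<open>Exponential rates and large deviations\<close>

text \<open>Substituting \<open>s = t * r\<close> gives \<open>x / t\<close> as the integral of
  \<open>cos (\<phi> (t * r))\<close> over \<open>[0, 1]\<close>, and
  \<open>r \<mapsto> \<phi> (t * r)\<close> is in law a Brownian path scaled by
  \<open>sqrt t\<close>. Hence the speed \<open>1 / t\<close>, and \<open>grid_energy n a\<close> is
  half the integral of the squared derivative of the piecewise linear path with increments
  \<open>a\<close> on steps of length \<open>1 / n\<close>. The obstacle is that the error of a
  fixed grid has a finite exponent. So \<open>n\<close> is chosen after the exponent and the radius,
  and only then \<open>t\<close> tends to 0; strict inequalities between exponents absorb constants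
  and errors. No variational problem is solved. \<open>meso_rate\<close> is the best exponent of
  upper bounds on small balls, so the upper half holds by construction. For the lower half, if on
  one fine grid all paths ending near \<open>q\<close> had energy at least \<open>c\<close>, an
  upper bound would beat the rate; hence cheap grid paths exist, and each of them yields a lower
  bound. As only finiteness is characterised, crude energy bounds suffice there.\<close>

definition exp_upper :: "(real \<Rightarrow> real) \<Rightarrow> real \<Rightarrow> bool" where
  "exp_upper f c \<longleftrightarrow> (\<forall>\<^sub>F t in at_right 0. f t \<le> exp (- c / t))"

text \<open>Both predicates avoid logarithms, so a vanishing probability is no special case and
  bounds on events can be added. If \<open>t * ln (f t)\<close> tends to \<open>- c\<close>, they
  hold for exponents strictly below, respectively above, \<open>c\<close>.\<close>

definition exp_lower :: "(real \<Rightarrow> real) \<Rightarrow> real \<Rightarrow> bool" where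
  "exp_lower f c \<longleftrightarrow> (\<forall>\<^sub>F t in at_right 0. exp (- c / t) \<le> f t)"

lemma eventually_at_right_0_pos: "\<forall>\<^sub>F t::real in at_right 0. 0 < t"
  by (simp add: eventually_at_right_less)

lemma eventually_at_right_0_less: "0 < (d::real) \<Longrightarrow> \<forall>\<^sub>F t in at_right 0. 0 < t \<and> t < d"
  using eventually_at_right[of 0 d] by fastforce

text \<open>A constant factor is free at the exponential scale: the gap \<open>c - d\<close>,
  divided by \<open>t\<close>, outgrows \<open>ln K\<close>.\<close>

lemma eventually_mult_exp_le:
  fixes K c d :: real
  assumes "d < c"
  shows "\<forall>\<^sub>F t in at_right 0. K * exp (- c / t) \<le> exp (- d / t)"
proof -
  \<comment> \<open>\<open>max K 1\<close> makes the logarithm nonnegative whatever the sign of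
    \<open>K\<close>; the added 1 keeps the denominator of \<open>e\<close> positive.\<close>
  define K' where "K' = max K 1"
  define e where "e = (c - d) / (ln K' + 1)"
  have K': "K' \<ge> 1" "K \<le> K'" by (auto simp: K'_def)
  have e: "e > 0" using K' assms by (simp add: e_def add_nonneg_pos)
  show ?thesis using eventually_at_right_0_less[OF e]
  proof eventually_elim
    case (elim t)
    have lp: "ln K' + 1 > 0" using K' by (simp add: add_nonneg_pos)
    have "t * (ln K' + 1) \<le> c - d" using elim lp by (simp add: e_def field_simps)
    hence "ln K' * t \<le> c - d" using elim by (simp add: algebra_simps)
    hence "ln K' \<le> (c - d) / t" using elim by (simp add: field_simps)
    hence "K' \<le> exp ((c - d) / t)" using K' by (metis exp_le_cancel_iff exp_ln less_le_trans zero_less_one)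
    hence "K \<le> exp ((c - d) / t)" using K' by linarith
    hence "K * exp (- c / t) \<le> exp ((c - d) / t) * exp (- c / t)" by (intro mult_right_mono) auto
    also have "\<dots> = exp (- d / t)" by (simp add: mult_exp_exp diff_divide_distrib)
    finally show ?case .
  qed
qed

lemma exp_upper_mono:
  assumes "exp_upper f c" "d \<le> c" "\<forall>\<^sub>F t in at_right 0. g t \<le> f t"
  shows "exp_upper g d"
  using assms(1) assms(3) eventually_at_right_0_pos unfolding exp_upper_def
proof eventually_elim
  case (elim t)
  have "exp (- c / t) \<le> exp (- d / t)" using elim assms(2) by (simp add: divide_right_mono)
  with elim show ?case by linarith
qed

lemma exp_lower_mono:
  assumes "exp_lower f c" "c \<le> d" "\<forall>\<^sub>F t in at_right 0. f t \<le> g t"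
  shows "exp_lower g d"
  using assms(1) assms(3) eventually_at_right_0_pos unfolding exp_lower_def
proof eventually_elim
  case (elim t)
  have "exp (- d / t) \<le> exp (- c / t)" using elim assms(2) by (simp add: divide_right_mono)
  with elim show ?case by linarith
qed

lemma exp_upper_add:
  assumes "exp_upper f c" "exp_upper g c" "d < c"
  shows "exp_upper (\<lambda>t. f t + g t) d"
  using assms(1,2) eventually_mult_exp_le[OF assms(3), of 2] unfolding exp_upper_def
  by eventually_elim linarith

text \<open>Eventually the subtracted term is at most half of \<open>exp (- c / t)\<close>, and the
  other half still exceeds \<open>exp (- d / t)\<close>. This removes an error event from a lower
  bound.\<close>

lemma exp_lower_diff:
  assumes "exp_lower f c" "exp_upper g c'" "c < c'" "c < d"
  shows "exp_lower (\<lambda>t. f t - g t) d"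
  using assms(1,2) eventually_mult_exp_le[OF assms(3), of 2] eventually_mult_exp_le[OF assms(4), of 2]
  unfolding exp_upper_def exp_lower_def
  by eventually_elim linarith

lemma exp_upper_sum:
  assumes "finite A" "\<And>a. a \<in> A \<Longrightarrow> exp_upper (f a) c" "d < c"
  shows "exp_upper (\<lambda>t. \<Sum>a\<in>A. f a t) d"
  using assms
proof (induction A arbitrary: d rule: finite_induct)
  case empty
  show ?case unfolding exp_upper_def by simp
next
  case (insert a A)
  \<comment> \<open>Each addition costs some exponent, so an intermediate \<open>e\<close> is
    inserted.\<close>
  from dense[OF insert.prems(2)] obtain e where e: "d < e" "e < c" by blast
  have "exp_upper (\<lambda>t. \<Sum>a\<in>A. f a t) e"
    using insert.prems(1) by (intro insert.IH[OF _ e(2)]) simp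
  moreover have "exp_upper (\<lambda>t. f a t) e"
    using insert.prems(1)[of a] e by (intro exp_upper_mono[of "f a" c e]) auto
  ultimately have "exp_upper (\<lambda>t. f a t + (\<Sum>a\<in>A. f a t)) d"
    using exp_upper_add[OF _ _ e(1)] by blast
  thus ?case using insert by simp
qed

text \<open>Handles the negative exponents that arise when the closed-set bound is tested below an
  infimum in \<open>[0, \<infinity>]\<close>.\<close>

lemma exp_upper_neg: "c \<le> 0 \<Longrightarrow> (\<And>t. 0 < t \<Longrightarrow> f t \<le> 1) \<Longrightarrow> exp_upper f c"
  unfolding exp_upper_def using eventually_at_right_0_pos
proof eventually_elim
  case (elim t)
  hence "0 \<le> - c / t" by (simp add: divide_nonpos_pos)
  hence "1 \<le> exp (- c / t)" by simp
  moreover have "f t \<le> 1" using elim by blast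
  ultimately show ?case by linarith
qed

lemma log_prob_mono: "0 \<le> r \<Longrightarrow> r \<le> s \<Longrightarrow> log_prob r \<le> log_prob s"
  by (auto simp: log_prob_def)

section \<open>From local exponential estimates to the large deviation principle\<close>

lemma Limsup_log_prob_le:
  assumes "exp_upper f c" "\<And>t. 0 < t \<Longrightarrow> 0 \<le> f t"
  shows "Limsup (at_right 0) (\<lambda>t. ereal t * log_prob (f t)) \<le> ereal (- c)"
proof (rule Limsup_bounded)
  show "\<forall>\<^sub>F t in at_right 0. ereal t * log_prob (f t) \<le> ereal (- c)"
    using assms(1) eventually_at_right_0_pos unfolding exp_upper_def
  proof eventually_elim
    case (elim t)
    show ?case
    proof (cases "f t = 0")
      case True
      then show ?thesis using elim by (simp add: log_prob_def)
    next
      case False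
      hence "f t > 0" using assms(2)[of t] elim by simp
      hence "ln (f t) \<le> - c / t" using elim by (metis ln_exp ln_mono)
      hence "t * ln (f t) \<le> - c" using elim by (simp add: field_simps)
      thus ?thesis using False by (simp add: log_prob_def)
    qed
  qed
qed

lemma Liminf_log_prob_ge:
  assumes "exp_lower f c"
  shows "ereal (- c) \<le> Liminf (at_right 0) (\<lambda>t. ereal t * log_prob (f t))"
proof (rule Liminf_bounded)
  show "\<forall>\<^sub>F t in at_right 0. ereal (- c) \<le> ereal t * log_prob (f t)"
    using assms(1) eventually_at_right_0_pos unfolding exp_lower_def
  proof eventually_elim
    case (elim t)
    have p: "f t > 0" using elim(1) exp_gt_zero[of "- c / t"] by linarith
    have "- c / t \<le> ln (f t)" using elim by (metis exp_gt_zero ln_exp ln_mono)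
    hence "- c \<le> t * ln (f t)" using elim by (simp add: field_simps)
    thus ?case using p by (simp add: log_prob_def)
  qed
qed

lemma ennreal_less_enn2ereal: "0 \<le> c \<Longrightarrow> ennreal c < x \<longleftrightarrow> ereal c < enn2ereal x"
  by (simp add: less_ennreal.rep_eq enn2ereal_ennreal)

lemma enn2ereal_less_ennreal: "0 \<le> c \<Longrightarrow> x < ennreal c \<longleftrightarrow> enn2ereal x < ereal c"
  by (simp add: less_ennreal.rep_eq enn2ereal_ennreal)

text \<open>Suppose a ball around \<open>q\<close> has upper exponent \<open>c'\<close> but
  \<open>I\<close> drops below \<open>c'\<close> at some \<open>q'\<close> in it. A small ball
  around \<open>q'\<close> inside the first one then has a lower exponent \<open>c'' < c'\<close>,
  contradicting monotonicity of \<open>P t\<close> for small \<open>t\<close>.\<close>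

lemma local_bounds_imp_lower_semicontinuous:
  fixes I :: "'b::metric_space \<Rightarrow> ennreal" and P :: "real \<Rightarrow> 'b set \<Rightarrow> real"
  assumes mono: "\<And>t A B. 0 < t \<Longrightarrow> open A \<Longrightarrow> open B \<Longrightarrow> A \<subseteq> B \<Longrightarrow> P t A \<le> P t B"
    and upper: "\<And>q c. 0 \<le> c \<Longrightarrow> ennreal c < I q \<Longrightarrow> \<exists>d>0. exp_upper (\<lambda>t. P t (ball q d)) c"
    and lower: "\<And>q c d. 0 < d \<Longrightarrow> 0 \<le> c \<Longrightarrow> I q < ennreal c \<Longrightarrow> exp_lower (\<lambda>t. P t (ball q d)) c"
  shows "lower_semicontinuous I"
  unfolding lower_semicontinuous_def
proof safe
  fix c
  show "open {x. c < I x}"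
    unfolding open_contains_ball
  proof safe
    fix q assume "c < I q"
    then obtain r where r: "c < r" "r < I q" using dense by blast
    then obtain c' where c': "0 \<le> c'" "r = ennreal c'"
      by (cases r) auto
    with upper r obtain d where d: "d > 0" "exp_upper (\<lambda>t. P t (ball q d)) c'" by blast
    have "c < I q'" if q': "q' \<in> ball q d" for q'
    proof (rule ccontr)
      assume "\<not> c < I q'"
      hence "I q' < ennreal c'" using r c' by auto
      then obtain s where s: "I q' < s" "s < ennreal c'" using dense by blast
      then obtain c'' where c'': "0 \<le> c''" "s = ennreal c''" by (cases s) auto
      have lt: "c'' < c'" using s c'' c' by (simp add: ennreal_less_iff)
      obtain e where e: "e > 0" "ball q' e \<subseteq> ball q d"
        using q' open_ball open_contains_ball by metis
      have 1: "exp_lower (\<lambda>t. P t (ball q' e)) c''" using lower e c'' s by blast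
      have 2: "\<forall>\<^sub>F t in at_right 0. 2 * exp (- c' / t) \<le> exp (- c'' / t)"
        by (rule eventually_mult_exp_le[OF lt])
      have "\<forall>\<^sub>F t::real in at_right 0. False"
        using 1 d(2) 2 eventually_at_right_0_pos unfolding exp_upper_def exp_lower_def
      proof eventually_elim
        case (elim t)
        have "P t (ball q' e) \<le> P t (ball q d)" using mono elim e by simp
        moreover have "exp (- c' / t) > 0" by simp
        ultimately show ?case using elim by linarith
      qed
      thus False by simp
    qed
    thus "\<exists>e>0. ball q e \<subseteq> {x. c < I x}" using d(1) by blast
  qed
qed

text \<open>\<open>\<nu> t\<close> stands for the law of the rescaled point. An open set contains a
  ball around a nearly optimal point. A closed set is covered by finitely many balls of good
  exponent up to the complement of a compact set, which tightness makes negligible.\<close>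

lemma large_deviation_principleI:
  fixes \<mu> \<nu> :: "real \<Rightarrow> R3 measure"
  assumes prob: "\<And>t. 0 < t \<Longrightarrow> prob_space (\<nu> t)"
    and sets: "\<And>t. 0 < t \<Longrightarrow> sets (\<nu> t) = sets borel"
    and \<mu>_eq: "\<And>t A. 0 < t \<Longrightarrow> A \<in> sets borel \<Longrightarrow> measure (\<mu> t) (sc t -` A) = measure (\<nu> t) A"
    and upper: "\<And>q c. 0 \<le> c \<Longrightarrow> ennreal c < I q \<Longrightarrow>
      \<exists>d>0. exp_upper (\<lambda>t. measure (\<nu> t) (ball q d)) c"
    and lower: "\<And>q c d. 0 < d \<Longrightarrow> 0 \<le> c \<Longrightarrow> I q < ennreal c \<Longrightarrow>
      exp_lower (\<lambda>t. measure (\<nu> t) (ball q d)) c"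
    and tight: "\<And>c. \<exists>K. compact K \<and> exp_upper (\<lambda>t. measure (\<nu> t) (- K)) c"
  shows "large_deviation_principle \<mu> sc I"
proof -
  let ?P = "\<lambda>t A. measure (\<nu> t) A"
  let ?R = "\<lambda>A t. ereal t * log_prob (measure (\<mu> t) (sc t -` A))"
  have mono: "?P t A \<le> ?P t B" if "0 < t" "A \<subseteq> B" "B \<in> sets borel" for t A B
  proof -
    interpret prob_space "\<nu> t" by (rule prob) fact
    show ?thesis using that sets by (intro finite_measure_mono) auto
  qed
  have sub: "?P t (A \<union> B) \<le> ?P t A + ?P t B" if "0 < t" "A \<in> sets borel" "B \<in> sets borel" for t A B
  proof -
    interpret prob_space "\<nu> t" by (rule prob) fact
    show ?thesis using that sets by (intro measure_Un_le) auto
  qed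
  have subU: "?P t (\<Union>a\<in>S. B a) \<le> (\<Sum>a\<in>S. ?P t (B a))"
    if "0 < t" "finite S" "\<And>a. a \<in> S \<Longrightarrow> B a \<in> sets borel" for t and S :: "R3 set" and B
  proof -
    interpret prob_space "\<nu> t" by (rule prob) fact
    show ?thesis using that sets by (intro measure_UNION_le) auto
  qed
  have le1: "?P t A \<le> 1" if "0 < t" for t A
  proof -
    interpret prob_space "\<nu> t" by (rule prob) fact
    show ?thesis by simp
  qed
  have ev_eq: "\<forall>\<^sub>F t in at_right 0. ?R A t = ereal t * log_prob (?P t A)" if "A \<in> sets borel" for A
    using eventually_at_right_0_pos by eventually_elim (simp add: \<mu>_eq that)
  have Liminf_eq: "Liminf (at_right 0) (?R A) = Liminf (at_right 0) (\<lambda>t. ereal t * log_prob (?P t A))"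
    if "A \<in> sets borel" for A
    by (rule Liminf_eq[OF ev_eq[OF that]])
  have Limsup_eq: "Limsup (at_right 0) (?R A) = Limsup (at_right 0) (\<lambda>t. ereal t * log_prob (?P t A))"
    if "A \<in> sets borel" for A
    by (rule Limsup_eq[OF ev_eq[OF that]])

  have open_bound: "- enn2ereal (INF q\<in>U. I q) \<le> Liminf (at_right 0) (?R U)" if "open U" for U
  proof -
    have U: "U \<in> sets borel" using that by simp
    \<comment> \<open>The infimum need not be attained, so the bound is tested against every
      \<open>x\<close> strictly above it.\<close>
    have "- Liminf (at_right 0) (\<lambda>t. ereal t * log_prob (?P t U)) \<le> x"
      if x: "enn2ereal (INF q\<in>U. I q) < x" for x
    proof (cases x)
      case (real c)
      have "0 \<le> enn2ereal (INF q\<in>U. I q)" by simp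
      hence c: "0 \<le> c" using x real by (metis ereal_less(5) less_imp_le order_le_less_trans zero_ereal_def ereal_less_eq(3))
      hence "(INF q\<in>U. I q) < ennreal c" using x real enn2ereal_less_ennreal by blast
      then obtain q where q: "q \<in> U" "I q < ennreal c" by (auto simp: INF_less_iff)
      obtain d where d: "d > 0" "ball q d \<subseteq> U" using \<open>open U\<close> q open_contains_ball by metis
      have "exp_lower (\<lambda>t. ?P t (ball q d)) c" using lower d q c by blast
      moreover have "\<forall>\<^sub>F t in at_right 0. ?P t (ball q d) \<le> ?P t U"
        using eventually_at_right_0_pos by eventually_elim (use d U mono in auto)
      ultimately have "exp_lower (\<lambda>t. ?P t U) c" by (blast intro: exp_lower_mono)
      from Liminf_log_prob_ge[OF this] show ?thesis
        unfolding real by (simp add: ereal_uminus_le_reorder)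
    qed (use x in auto)
    hence "- Liminf (at_right 0) (\<lambda>t. ereal t * log_prob (?P t U)) \<le> enn2ereal (INF q\<in>U. I q)"
      by (rule dense_ge)
    thus ?thesis unfolding Liminf_eq[OF U] by (simp add: ereal_uminus_le_reorder)
  qed

  have closed_bound: "Limsup (at_right 0) (?R F) \<le> - enn2ereal (INF q\<in>F. I q)" if "closed F" for F
  proof -
    have F: "F \<in> sets borel" using that by simp
    have key: "exp_upper (\<lambda>t. ?P t F) c" if c: "ereal c < enn2ereal (INF q\<in>F. I q)" for c
    proof (cases "c < 0")
      case True
      thus ?thesis using le1 by (intro exp_upper_neg) auto
    next
      case False
      obtain e where e: "ereal c < ereal e" "ereal e < enn2ereal (INF q\<in>F. I q)"
        using c ereal_dense2 by blast
      have lt: "c < e" and e0: "0 \<le> e" using e(1) False by auto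
      \<comment> \<open>Two losses are planned: the finite sum over balls takes \<open>e\<close>
        down to \<open>c'\<close>, adding the complement of \<open>K\<close> takes \<open>c'\<close>
        down to \<open>c\<close>.\<close>
      obtain c' where c': "c < c'" "c' < e" using dense[OF lt] by blast
      obtain K where K: "compact K" "exp_upper (\<lambda>t. ?P t (- K)) c'" using tight by blast
      have "ennreal e < I q" if "q \<in> F" for q
        using e e0 that by (metis INF_lower ennreal_less_enn2ereal order_less_le_trans)
      hence "\<forall>q\<in>F. \<exists>d>0. exp_upper (\<lambda>t. ?P t (ball q d)) e" using upper e0 by blast
      then obtain d where d: "\<And>q. q \<in> F \<Longrightarrow> d q > 0 \<and> exp_upper (\<lambda>t. ?P t (ball q (d q))) e"
        by metis
      have "compact (F \<inter> K)" using \<open>closed F\<close> K by (simp add: closed_Int_compact)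
      moreover have "\<forall>B\<in>(\<lambda>q. ball q (d q)) ` F. open B" by simp
      moreover have "F \<inter> K \<subseteq> \<Union>((\<lambda>q. ball q (d q)) ` F)"
        using d by (auto intro!: bexI)
      ultimately obtain S where S: "S \<subseteq> F" "finite S" "F \<inter> K \<subseteq> (\<Union>q\<in>S. ball q (d q))"
        using compactE_image[of "F \<inter> K" F "\<lambda>q. ball q (d q)"] by (metis open_ball)
      have 1: "exp_upper (\<lambda>t. \<Sum>q\<in>S. ?P t (ball q (d q))) c'"
        using S d c' by (intro exp_upper_sum[where c = e]) auto
      have "exp_upper (\<lambda>t. (\<Sum>q\<in>S. ?P t (ball q (d q))) + ?P t (- K)) c"
        by (rule exp_upper_add[OF 1 K(2) c'(1)])
      moreover have "\<forall>\<^sub>F t in at_right 0. ?P t F \<le> (\<Sum>q\<in>S. ?P t (ball q (d q))) + ?P t (- K)"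
        using eventually_at_right_0_pos
      proof eventually_elim
        case (elim t)
        have Kb: "- K \<in> sets borel" using K(1) by (simp add: compact_imp_closed borel_open open_Compl)
        have Ub: "(\<Union>q\<in>S. ball q (d q)) \<in> sets borel" by (intro borel_open open_UN) auto
        have "?P t F \<le> ?P t ((\<Union>q\<in>S. ball q (d q)) \<union> - K)"
          using S by (intro mono[OF elim _ sets.Un[OF Ub Kb]]) auto
        also have "\<dots> \<le> ?P t (\<Union>q\<in>S. ball q (d q)) + ?P t (- K)"
          by (rule sub[OF elim Ub Kb])
        also have "?P t (\<Union>q\<in>S. ball q (d q)) \<le> (\<Sum>q\<in>S. ?P t (ball q (d q)))"
          using S elim by (intro subU) auto
        finally show ?case by simp
      qed
      ultimately show ?thesis by (blast intro: exp_upper_mono)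
    qed
    have "x \<le> - Limsup (at_right 0) (\<lambda>t. ereal t * log_prob (?P t F))"
      if x: "x < enn2ereal (INF q\<in>F. I q)" for x
    proof (cases x)
      case (real c)
      have "Limsup (at_right 0) (\<lambda>t. ereal t * log_prob (?P t F)) \<le> ereal (- c)"
        using key x real by (intro Limsup_log_prob_le) auto
      thus ?thesis unfolding real by (metis ereal_minus_le_minus uminus_ereal.simps(1) ereal_uminus_uminus)
    qed (use x in auto)
    hence "enn2ereal (INF q\<in>F. I q) \<le> - Limsup (at_right 0) (\<lambda>t. ereal t * log_prob (?P t F))"
      by (rule dense_le)
    thus ?thesis unfolding Limsup_eq[OF F] by (metis ereal_minus_le_minus ereal_uminus_uminus)
  qed

  have middle: "Liminf (at_right 0) (?R U) \<le> Limsup (at_right 0) (?R F)"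
    if "open U" "closed F" "U \<subseteq> F" for U F
  proof -
    have UF: "U \<in> sets borel" "F \<in> sets borel" using that by auto
    have "Liminf (at_right 0) (?R U) \<le> Liminf (at_right 0) (?R F)"
    proof (rule Liminf_mono)
      show "\<forall>\<^sub>F t in at_right 0. ?R U t \<le> ?R F t"
        using eventually_at_right_0_pos
      proof eventually_elim
        case (elim t)
        have "log_prob (?P t U) \<le> log_prob (?P t F)"
          using mono[OF elim that(3) UF(2)] by (intro log_prob_mono) auto
        thus ?case using elim UF by (simp add: \<mu>_eq ereal_mult_left_mono)
      qed
    qed
    also have "\<dots> \<le> Limsup (at_right 0) (?R F)" by (rule Liminf_le_Limsup) simp
    finally show ?thesis .
  qed
  have "lower_semicontinuous I"
    using mono upper lower by (intro local_bounds_imp_lower_semicontinuous[where P = ?P]) auto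
  with open_bound closed_bound middle show ?thesis
    unfolding large_deviation_principle_def by blast
qed

section \<open>Gaussian increments\<close>

lemma nn_integral_normal_density:
  "0 < \<sigma> \<Longrightarrow> (\<integral>\<^sup>+x. ennreal (normal_density \<mu> \<sigma> x) \<partial>lborel) = 1"
  by (subst nn_integral_eq_integral) auto

text \<open>The weight cancels all but the fraction \<open>e\<close> of the quadratic exponent,
  leaving a Gaussian of variance \<open>\<sigma>\<^sup>2 / e\<close>; \<open>e > 0\<close> keeps it
  integrable.\<close>

lemma normal_density_0_tilt_square:
  assumes "0 < \<sigma>" "0 < e"
  shows "normal_density 0 \<sigma> x * exp ((1 - e) * x\<^sup>2 / (2 * \<sigma>\<^sup>2)) =
    1 / sqrt e * normal_density 0 (\<sigma> / sqrt e) x"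
proof -
  have "exp (- (x\<^sup>2 / (2 * \<sigma>\<^sup>2))) * exp ((1 - e) * x\<^sup>2 / (2 * \<sigma>\<^sup>2)) = exp (- (x\<^sup>2 * e / (2 * \<sigma>\<^sup>2)))"
    using assms unfolding mult_exp_exp by (simp add: field_simps)
  thus ?thesis using assms
    by (simp add: normal_density_def power_divide real_sqrt_mult real_sqrt_divide)
qed

text \<open>Completing the square.\<close>

lemma normal_density_0_tilt:
  assumes "0 < \<sigma>"
  shows "normal_density 0 \<sigma> x * exp (l * x) = exp (l\<^sup>2 * \<sigma>\<^sup>2 / 2) * normal_density (l * \<sigma>\<^sup>2) \<sigma> x"
proof -
  have "exp (- (x\<^sup>2 / (2 * \<sigma>\<^sup>2))) * exp (l * x) =
    exp (l\<^sup>2 * \<sigma>\<^sup>2 / 2) * exp (- ((x - l * \<sigma>\<^sup>2)\<^sup>2 / (2 * \<sigma>\<^sup>2)))"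
    using assms unfolding mult_exp_exp by (simp add: field_simps power2_eq_square)
  thus ?thesis by (simp add: normal_density_def)
qed

context prob_space
begin

lemma normal_nn_integral_exp_square:
  assumes X: "distributed M lborel X (normal_density 0 \<sigma>)" and "0 < \<sigma>" "0 < e"
  shows "(\<integral>\<^sup>+\<omega>. ennreal (exp ((1 - e) * (X \<omega>)\<^sup>2 / (2 * \<sigma>\<^sup>2))) \<partial>M) = ennreal (1 / sqrt e)"
proof -
  have "(\<integral>\<^sup>+\<omega>. ennreal (exp ((1 - e) * (X \<omega>)\<^sup>2 / (2 * \<sigma>\<^sup>2))) \<partial>M) =
    (\<integral>\<^sup>+x. ennreal (normal_density 0 \<sigma> x) * ennreal (exp ((1 - e) * x\<^sup>2 / (2 * \<sigma>\<^sup>2))) \<partial>lborel)"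
    by (rule distributed_nn_integral[symmetric, OF X]) measurable
  also have "\<dots> = (\<integral>\<^sup>+x. ennreal (1 / sqrt e) * ennreal (normal_density 0 (\<sigma> / sqrt e) x) \<partial>lborel)"
    using assms by (simp flip: ennreal_mult add: normal_density_0_tilt_square)
  also have "\<dots> = ennreal (1 / sqrt e)"
    using assms by (simp add: nn_integral_cmult nn_integral_normal_density)
  finally show ?thesis .
qed

lemma normal_nn_integral_exp:
  assumes X: "distributed M lborel X (normal_density 0 \<sigma>)" and "0 < \<sigma>"
  shows "(\<integral>\<^sup>+\<omega>. ennreal (exp (l * X \<omega>)) \<partial>M) = ennreal (exp (l\<^sup>2 * \<sigma>\<^sup>2 / 2))"
proof -
  have "(\<integral>\<^sup>+\<omega>. ennreal (exp (l * X \<omega>)) \<partial>M) =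
    (\<integral>\<^sup>+x. ennreal (normal_density 0 \<sigma> x) * ennreal (exp (l * x)) \<partial>lborel)"
    by (rule distributed_nn_integral[symmetric, OF X]) measurable
  also have "\<dots> = (\<integral>\<^sup>+x. ennreal (exp (l\<^sup>2 * \<sigma>\<^sup>2 / 2)) * ennreal (normal_density (l * \<sigma>\<^sup>2) \<sigma> x) \<partial>lborel)"
    using assms by (simp flip: ennreal_mult add: normal_density_0_tilt)
  also have "\<dots> = ennreal (exp (l\<^sup>2 * \<sigma>\<^sup>2 / 2))"
    using assms by (simp add: nn_integral_cmult nn_integral_normal_density)
  finally show ?thesis .
qed

text \<open>\<open>exp (l * \<bar>x\<bar>)\<close> is one of \<open>exp (l * x)\<close> and
  \<open>exp (- l * x)\<close>, hence at most their sum. This is the origin of the factor 2 in the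
  sampling error.\<close>

lemma normal_nn_integral_exp_abs_le:
  assumes X: "distributed M lborel X (normal_density 0 \<sigma>)" and "0 < \<sigma>"
  shows "(\<integral>\<^sup>+\<omega>. ennreal (exp (l * \<bar>X \<omega>\<bar>)) \<partial>M) \<le> ennreal (2 * exp (l\<^sup>2 * \<sigma>\<^sup>2 / 2))"
proof -
  have [measurable]: "X \<in> borel_measurable M"
    using distributed_measurable[OF X] by simp
  have "(\<integral>\<^sup>+\<omega>. ennreal (exp (l * \<bar>X \<omega>\<bar>)) \<partial>M) \<le>
    (\<integral>\<^sup>+\<omega>. ennreal (exp (l * X \<omega>)) + ennreal (exp (- l * X \<omega>)) \<partial>M)"
    by (intro nn_integral_mono) (auto simp flip: ennreal_plus simp: abs_if)
  also have "\<dots> = ennreal (exp (l\<^sup>2 * \<sigma>\<^sup>2 / 2)) + ennreal (exp ((- l)\<^sup>2 * \<sigma>\<^sup>2 / 2))"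
    by (subst nn_integral_add) (auto simp only: normal_nn_integral_exp[OF assms], measurable)
  also have "\<dots> = ennreal (2 * exp (l\<^sup>2 * \<sigma>\<^sup>2 / 2))"
    by (simp flip: ennreal_plus)
  finally show ?thesis .
qed

text \<open>The length of the interval times the density at \<open>\<bar>a\<bar> + d\<close>, a
  lower bound for the density throughout the interval.\<close>

lemma normal_prob_near_ge:
  assumes X: "distributed M lborel X (normal_density 0 \<sigma>)" and "0 < \<sigma>" "0 < d"
  shows "2 * d / (sqrt (2 * pi) * \<sigma>) * exp (- (\<bar>a\<bar> + d)\<^sup>2 / (2 * \<sigma>\<^sup>2)) \<le>
    prob {\<omega> \<in> space M. \<bar>X \<omega> - a\<bar> < d}"
proof -
  define k where "k = 1 / (sqrt (2 * pi) * \<sigma>) * exp (- (\<bar>a\<bar> + d)\<^sup>2 / (2 * \<sigma>\<^sup>2))"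
  have k0: "k \<ge> 0" using assms by (simp add: k_def)
  have dens: "k \<le> normal_density 0 \<sigma> x" if "x \<in> {a - d<..<a + d}" for x
  proof -
    have "\<bar>x\<bar> \<le> \<bar>a\<bar> + d" using that by auto
    hence "x\<^sup>2 \<le> (\<bar>a\<bar> + d)\<^sup>2" by (metis abs_ge_zero power2_abs power_mono)
    hence "exp (- (\<bar>a\<bar> + d)\<^sup>2 / (2 * \<sigma>\<^sup>2)) \<le> exp (- x\<^sup>2 / (2 * \<sigma>\<^sup>2))"
      by (auto intro!: divide_right_mono)
    moreover have "sqrt (2 * pi * \<sigma>\<^sup>2) = sqrt (2 * pi) * \<sigma>"
      using assms by (simp add: real_sqrt_mult)
    ultimately show ?thesis using assms
      by (simp add: k_def normal_density_def divide_right_mono)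
  qed
  have "ennreal (k * (2 * d)) = (\<integral>\<^sup>+x. ennreal k * indicator {a - d<..<a + d} x \<partial>lborel)"
    using assms k0 by (simp add: nn_integral_cmult_indicator ennreal_mult)
  also have "\<dots> \<le> (\<integral>\<^sup>+x. ennreal (normal_density 0 \<sigma> x) * indicator {a - d<..<a + d} x \<partial>lborel)"
    using dens by (intro nn_integral_mono) (auto simp: indicator_def intro!: ennreal_leI)
  also have "\<dots> = emeasure M (X -` {a - d<..<a + d} \<inter> space M)"
    by (rule distributed_emeasure[symmetric, OF X]) simp
  also have "X -` {a - d<..<a + d} \<inter> space M = {\<omega> \<in> space M. \<bar>X \<omega> - a\<bar> < d}"
    by auto
  finally have "k * (2 * d) \<le> prob {\<omega> \<in> space M. \<bar>X \<omega> - a\<bar> < d}"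
    by (simp add: emeasure_eq_measure)
  thus ?thesis by (simp add: k_def mult_ac)
qed

end

section \<open>Energy of the increments on an equidistant grid\<close>

context standard_brownian_motion
begin

definition increment :: "real \<Rightarrow> nat \<Rightarrow> nat \<Rightarrow> 'a \<Rightarrow> real" where
  "increment t n i \<omega> = W (t * real (Suc i) / real n) \<omega> - W (t * real i / real n) \<omega>"

lemma random_variable_increment [measurable]:
  "0 \<le> t \<Longrightarrow> random_variable borel (increment t n i)"
  unfolding increment_def[abs_def]
  by (intro borel_measurable_diff random_variable_W) auto

lemma distributed_increment:
  assumes "0 < t" "0 < n"
  shows "distributed M lborel (increment t n i) (normal_density 0 (sqrt (t / n)))"
proof -
  have "t * real (Suc i) / n - t * real i / n = t / n" by (simp add: distrib_left add_divide_distrib)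
  moreover have "t * real i / n < t * real (Suc i) / n"
    using assms by (simp add: divide_strict_right_mono)
  ultimately show ?thesis
    using normal_increments[of "t * real i / n" "t * real (Suc i) / n"] assms
    unfolding increment_def[abs_def] by simp
qed

lemma indep_vars_increment:
  assumes "0 < t" "0 < n"
  shows "indep_vars (\<lambda>_. borel) (increment t n) {..<n}"
proof -
  have "mono (\<lambda>i::nat. t * real i / n)"
    using assms by (auto intro!: monoI divide_right_mono mult_left_mono)
  from indep_increments[OF _ this] show ?thesis unfolding increment_def[abs_def] by simp
qed

text \<open>Exponential Markov inequality with weight \<open>(1 - e) / t\<close>. The variance of an
  increment is \<open>t / n\<close>, so the weighted energy is the sum of the exponents in
  \<open>normal_nn_integral_exp_square\<close>; by independence the moments multiply to
  \<open>(1 / sqrt e) ^ n\<close>, which does not depend on \<open>t\<close>.\<close>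

lemma exp_upper_energy:
  assumes n: "0 < n" and "c < m"
  shows "exp_upper (\<lambda>t. prob {\<omega> \<in> space M. m \<le> real n / 2 * (\<Sum>i<n. (increment t n i \<omega>)\<^sup>2)}) c"
proof -
  \<comment> \<open>Chosen so that \<open>c < (1 - e) * m\<close> also for negative
    \<open>m\<close>, hence the absolute value; the minimum with \<open>1 / 2\<close> ensures
    \<open>e < 1\<close>.\<close>
  define e where "e = min (1 / 2) ((m - c) / (2 * (\<bar>m\<bar> + 1)))"
  have e: "0 < e" "e < 1" using assms by (auto simp: e_def)
  have "e * (2 * (\<bar>m\<bar> + 1)) \<le> m - c"
    unfolding e_def by (subst pos_le_divide_eq[symmetric]) (auto simp: add_pos_nonneg)
  moreover have "e * m \<le> e * \<bar>m\<bar>" using e by simp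
  ultimately have "c + e * m < m" using e mult_nonneg_nonneg[of e "\<bar>m\<bar>"] unfolding distrib_left by linarith
  hence em: "c < (1 - e) * m" by (simp add: algebra_simps)
  define K where "K = (1 / sqrt e) ^ n"
  have K: "K \<ge> 0" using e by (simp add: K_def)
  have bound: "prob {\<omega> \<in> space M. m \<le> real n / 2 * (\<Sum>i<n. (increment t n i \<omega>)\<^sup>2)} \<le>
      K * exp (- ((1 - e) * m) / t)" (is "prob ?A \<le> _") if t: "0 < t" for t
  proof -
    let ?G = "increment t n"
    define s where "s = sqrt (t / n)"
    have s: "s > 0" "s\<^sup>2 = t / n" using t n by (auto simp: s_def)
    let ?f = "\<lambda>i \<omega>. ennreal (exp ((1 - e) * (?G i \<omega>)\<^sup>2 / (2 * s\<^sup>2)))"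
    have [measurable]: "?G i \<in> borel_measurable M" for i using t by simp
    have pw: "indicator ?A \<omega> \<le> ennreal (exp (- ((1 - e) * m) / t)) * (\<Prod>i<n. ?f i \<omega>)"
      if "\<omega> \<in> space M" for \<omega>
    proof (cases "\<omega> \<in> ?A")
      case True
      have "(\<Sum>i<n. (1 - e) * (?G i \<omega>)\<^sup>2 / (2 * s\<^sup>2)) = (1 - e) / t * (real n / 2 * (\<Sum>i<n. (?G i \<omega>)\<^sup>2))"
        using t n unfolding s sum_distrib_left by (intro sum.cong) (auto simp: field_simps)
      moreover have "(1 - e) / t * m \<le> (1 - e) / t * (real n / 2 * (\<Sum>i<n. (?G i \<omega>)\<^sup>2))"
        using True e t by (intro mult_left_mono) auto
      ultimately have "1 \<le> exp (- ((1 - e) * m) / t + (\<Sum>i<n. (1 - e) * (?G i \<omega>)\<^sup>2 / (2 * s\<^sup>2)))"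
        by simp
      hence "1 \<le> exp (- ((1 - e) * m) / t) * (\<Prod>i<n. exp ((1 - e) * (?G i \<omega>)\<^sup>2 / (2 * s\<^sup>2)))"
        by (simp only: exp_add exp_sum finite_lessThan)
      thus ?thesis using True
        by (simp add: prod_ennreal prod_nonneg ennreal_leI flip: ennreal_mult ennreal_1 del: ennreal_eq_1)
    qed auto
    have A: "?A \<in> sets M" by measurable
    have "emeasure M ?A = (\<integral>\<^sup>+\<omega>. indicator ?A \<omega> \<partial>M)" using A by simp
    also have "\<dots> \<le> (\<integral>\<^sup>+\<omega>. ennreal (exp (- ((1 - e) * m) / t)) * (\<Prod>i<n. ?f i \<omega>) \<partial>M)"
      using pw by (intro nn_integral_mono)
    also have "\<dots> = ennreal (exp (- ((1 - e) * m) / t)) * (\<integral>\<^sup>+\<omega>. (\<Prod>i<n. ?f i \<omega>) \<partial>M)"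
      by (rule nn_integral_cmult) measurable
    also have "(\<integral>\<^sup>+\<omega>. (\<Prod>i<n. ?f i \<omega>) \<partial>M) = (\<Prod>i<n. \<integral>\<^sup>+\<omega>. ?f i \<omega> \<partial>M)"
      by (intro indep_vars_nn_integral indep_vars_compose2[OF indep_vars_increment[OF t n]])
        (auto, measurable)
    also have "\<dots> = (\<Prod>i<n. ennreal (1 / sqrt e))"
      using normal_nn_integral_exp_square[OF distributed_increment[OF t n], folded s_def] s e
      by simp
    also have "\<dots> = ennreal K" using e by (simp add: K_def ennreal_power)
    finally have "ennreal (prob ?A) \<le> ennreal (exp (- ((1 - e) * m) / t) * K)"
      using K by (simp add: emeasure_eq_measure ennreal_mult)
    thus ?thesis using K by (simp add: mult.commute)
  qed
  show ?thesis
    using eventually_mult_exp_le[OF em, of K] eventually_at_right_0_pos unfolding exp_upper_def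
    by eventually_elim (use bound in fastforce)
qed

lemma exp_lower_increment:
  assumes n: "0 < n" and "0 < d" and c: "real n / 2 * (\<bar>a\<bar> + d)\<^sup>2 \<le> c"
  shows "exp_lower (\<lambda>t. prob {\<omega> \<in> space M. \<bar>increment t n i \<omega> - a\<bar> < d}) c"
proof -
  \<comment> \<open>Below \<open>t0\<close> the prefactor \<open>2 * d / (sqrt (2 * pi) * s)\<close>
    of the density bound is at least 1, for every \<open>n\<close>.\<close>
  define t0 where "t0 = 2 * d\<^sup>2 / pi"
  have t0: "t0 > 0" using assms by (simp add: t0_def)
  show ?thesis
    using eventually_at_right_0_less[OF t0] unfolding exp_lower_def
  proof eventually_elim
    case (elim t)
    define s where "s = sqrt (t / n)"
    have s: "s > 0" "s\<^sup>2 = t / n" using elim n by (auto simp: s_def)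
    have "(sqrt (2 * pi) * s)\<^sup>2 = 2 * pi * t / n" using s by (simp add: power_mult_distrib)
    also have "\<dots> \<le> 2 * pi * t"
      using n elim by (simp add: divide_le_eq)
    also have "\<dots> \<le> (2 * d)\<^sup>2" using elim by (simp add: t0_def field_simps power2_eq_square)
    finally have "sqrt (2 * pi) * s \<le> 2 * d" using assms by (meson mult_nonneg_nonneg less_imp_le power2_le_imp_le zero_le_numeral)
    hence 1: "1 \<le> 2 * d / (sqrt (2 * pi) * s)" using s by simp
    have "- c / t \<le> - (real n / 2 * (\<bar>a\<bar> + d)\<^sup>2) / t" using c elim by (intro divide_right_mono) auto
    also have "\<dots> = - (\<bar>a\<bar> + d)\<^sup>2 / (2 * s\<^sup>2)"
      using elim n by (simp add: s field_simps)
    finally have "exp (- c / t) \<le> 1 * exp (- (\<bar>a\<bar> + d)\<^sup>2 / (2 * s\<^sup>2))" by simp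
    also have "\<dots> \<le> 2 * d / (sqrt (2 * pi) * s) * exp (- (\<bar>a\<bar> + d)\<^sup>2 / (2 * s\<^sup>2))"
      using 1 by (intro mult_right_mono) auto
    also have "\<dots> \<le> prob {\<omega> \<in> space M. \<bar>increment t n i \<omega> - a\<bar> < d}"
      using distributed_increment[of t n i] elim n assms s
      by (intro normal_prob_near_ge) (auto simp: s_def)
    finally show ?case .
  qed
qed

text \<open>By independence the one-dimensional exponents add up. Each of them is inflated by the
  radius, so \<open>d\<close> is first shrunk to an \<open>h\<close> for which the total stays below
  \<open>c\<close>.\<close>

lemma exp_lower_increments:
  assumes n: "0 < n" and "0 < d" and c: "real n / 2 * (\<Sum>i<n. (a i)\<^sup>2) < c"
  shows "exp_lower (\<lambda>t. prob {\<omega> \<in> space M. \<forall>i<n. \<bar>increment t n i \<omega> - a i\<bar> < d}) c"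
proof -
  have "((\<lambda>h. real n / 2 * (\<Sum>i<n. (\<bar>a i\<bar> + h)\<^sup>2)) \<longlongrightarrow> real n / 2 * (\<Sum>i<n. (\<bar>a i\<bar> + 0)\<^sup>2)) (at_right 0)"
    by (intro tendsto_intros)
  hence "\<forall>\<^sub>F h in at_right 0. real n / 2 * (\<Sum>i<n. (\<bar>a i\<bar> + h)\<^sup>2) < c"
    using c by (intro order_tendstoD) auto
  with eventually_at_right_0_less[OF \<open>0 < d\<close>]
  have "\<forall>\<^sub>F h in at_right 0. 0 < h \<and> h < d \<and> real n / 2 * (\<Sum>i<n. (\<bar>a i\<bar> + h)\<^sup>2) < c"
    by eventually_elim simp
  then obtain h where h: "0 < h" "h < d" "real n / 2 * (\<Sum>i<n. (\<bar>a i\<bar> + h)\<^sup>2) < c"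
    using eventually_happens[of _ "at_right (0::real)"] by force
  have "\<forall>i. exp_lower (\<lambda>t. prob {\<omega> \<in> space M. \<bar>increment t n i \<omega> - a i\<bar> < h}) (real n / 2 * (\<bar>a i\<bar> + h)\<^sup>2)"
    using n h by (intro allI exp_lower_increment) auto
  hence "\<forall>\<^sub>F t in at_right 0. \<forall>i\<in>{..<n}. exp (- (real n / 2 * (\<bar>a i\<bar> + h)\<^sup>2) / t) \<le>
     prob {\<omega> \<in> space M. \<bar>increment t n i \<omega> - a i\<bar> < h}"
    unfolding exp_lower_def by (intro eventually_ball_finite) auto
  thus ?thesis using eventually_at_right_0_pos unfolding exp_lower_def
  proof eventually_elim
    case (elim t)
    let ?G = "increment t n"
    have [measurable]: "?G i \<in> borel_measurable M" for i using elim by simp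
    have "- c / t \<le> - (real n / 2 * (\<Sum>i<n. (\<bar>a i\<bar> + h)\<^sup>2)) / t"
      using elim h by (intro divide_right_mono) auto
    also have "\<dots> = (\<Sum>i<n. - (real n / 2 * (\<bar>a i\<bar> + h)\<^sup>2) / t)"
      by (simp add: sum_distrib_left sum_divide_distrib sum_negf)
    finally have "exp (- c / t) \<le> (\<Prod>i<n. exp (- (real n / 2 * (\<bar>a i\<bar> + h)\<^sup>2) / t))"
      by (simp flip: exp_sum)
    also have "\<dots> \<le> (\<Prod>i<n. prob {\<omega> \<in> space M. \<bar>?G i \<omega> - a i\<bar> < h})"
      using elim by (intro prod_mono) auto
    also have "\<dots> = (\<Prod>i<n. prob (?G i -` {a i - h<..<a i + h} \<inter> space M))"
      by (intro prod.cong arg_cong[where f = prob]) auto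
    also have "\<dots> = prob (\<Inter>i\<in>{..<n}. ?G i -` {a i - h<..<a i + h} \<inter> space M)"
      using n elim by (intro indep_varsD_finite[OF indep_vars_increment, symmetric]) auto
    also have "\<dots> \<le> prob {\<omega> \<in> space M. \<forall>i<n. \<bar>?G i \<omega> - a i\<bar> < d}"
    proof (rule finite_measure_mono)
      show "(\<Inter>i\<in>{..<n}. ?G i -` {a i - h<..<a i + h} \<inter> space M) \<subseteq>
        {\<omega> \<in> space M. \<forall>i<n. \<bar>?G i \<omega> - a i\<bar> < d}"
      proof safe
        fix \<omega> assume *: "\<omega> \<in> (\<Inter>i\<in>{..<n}. ?G i -` {a i - h<..<a i + h} \<inter> space M)"
        show "\<omega> \<in> space M" using * n by blast
        fix i assume "i < n"
        hence "?G i \<omega> \<in> {a i - h<..<a i + h}" using * by blast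
        thus "\<bar>?G i \<omega> - a i\<bar> < d" using h by auto
      qed
      show "{\<omega> \<in> space M. \<forall>i<n. \<bar>?G i \<omega> - a i\<bar> < d} \<in> events" by measurable
    qed
    finally show ?case .
  qed
qed

end

section \<open>The sampling error\<close>

text \<open>The oscillation is controlled only at distance \<open>t / n\<close>, so that the lemma
  serves both uniformly continuous integrands and sampled Lipschitz paths.\<close>

lemma riemann_sum_error:
  fixes f :: "real \<Rightarrow> real" and n :: nat and t e :: real
  assumes f: "(f has_integral x) {0..t}" and "0 < t" "0 < n" and "0 \<le> e"
    and e: "\<And>s s'. s \<in> {0..t} \<Longrightarrow> s' \<in> {0..t} \<Longrightarrow> \<bar>s - s'\<bar> \<le> t / n \<Longrightarrow> \<bar>f s - f s'\<bar> \<le> e"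
  shows "\<bar>x / t - 1 / n * (\<Sum>k<n. f (t * real k / real n))\<bar> \<le> e"
proof -
  have int: "f integrable_on {a..b}" if "0 \<le> a" "b \<le> t" for a b
    using that by (intro integrable_on_subinterval[OF has_integral_integrable[OF f]]) auto
  have "\<bar>integral {0..t * real k / real n} f - t / n * (\<Sum>j<k. f (t * real j / real n))\<bar> \<le> e * (t * real k / real n)" if "k \<le> n" for k
    using that
  proof (induction k)
    case 0
    then show ?case by simp
  next
    case (Suc k)
    define a b where "a = t * real k / real n" and "b = t * Suc k / n"
    have ba: "b - a = t / n" using assms by (simp add: a_def b_def distrib_left add_divide_distrib)
    have "b \<le> t * n / n" unfolding b_def using assms Suc.prems
      by (intro divide_right_mono mult_left_mono) auto
    moreover have "0 \<le> a" "0 < t / n" using assms by (auto simp: a_def)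
    moreover have "t * n / n = t" using assms by simp
    ultimately have ab: "0 \<le> a" "a \<le> b" "b \<le> t" using ba by linarith+
    have 1: "integral {0..b} f = integral {0..a} f + integral {a..b} f"
      using ab int by (intro Henstock_Kurzweil_Integration.integral_combine[symmetric]) auto
    have "((\<lambda>s. f s - f a) has_integral (integral {a..b} f - (b - a) * f a)) {a..b}"
      using has_integral_diff[OF integrable_integral[OF int[of a b]] has_integral_const_real[of "f a" a b]] ab
      by simp
    from has_integral_bound_real[OF _ _ this, of e "{}"]
    have 2: "\<bar>integral {a..b} f - t / n * f a\<bar> \<le> e * (t / n)"
      using ab assms e[of _ a] ba by (simp add: abs_if)
    have "\<bar>integral {0..b} f - t / n * (\<Sum>j<Suc k. f (t * real j / real n))\<bar> \<le> e * a + e * (t / n)"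
      using Suc 2 unfolding 1 by (simp add: a_def distrib_left)
    also have "\<dots> = e * b" using ba by (simp add: algebra_simps)
    finally show ?case unfolding b_def .
  qed
  from this[of n] have "\<bar>x - t / n * (\<Sum>j<n. f (t * real j / real n))\<bar> \<le> e * t"
    using f assms by (simp add: integral_unique)
  hence "\<bar>x - t / n * (\<Sum>j<n. f (t * real j / real n))\<bar> / t \<le> e" using assms by (simp add: divide_le_eq)
  also have "\<bar>x - t / n * (\<Sum>j<n. f (t * real j / real n))\<bar> / t = \<bar>(x - t / n * (\<Sum>j<n. f (t * real j / real n))) / t\<bar>"
    using assms by simp
  also have "(x - t / n * (\<Sum>j<n. f (t * real j / real n))) / t = x / t - 1 / n * (\<Sum>k<n. f (t * real k / real n))"
    using assms by (simp add: diff_divide_distrib)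
  finally show ?thesis .
qed

lemma riemann_sum_tendsto:
  fixes f :: "real \<Rightarrow> real" and t :: real
  assumes f: "(f has_integral x) {0..t}" "0 < t" and cont: "continuous_on {0..t} f"
  shows "(\<lambda>n::nat. 1 / n * (\<Sum>k<n. f (t * real k / real n))) \<longlonglongrightarrow> x / t"
proof (rule LIMSEQ_I)
  fix r :: real assume r: "0 < r"
  have "uniformly_continuous_on {0..t} f" using cont by (intro compact_uniformly_continuous) auto
  then obtain d where d: "d > 0"
    "\<And>s s'. s \<in> {0..t} \<Longrightarrow> s' \<in> {0..t} \<Longrightarrow> dist s' s < d \<Longrightarrow> dist (f s') (f s) < r / 2"
    using r unfolding uniformly_continuous_on_def by (metis half_gt_zero)
  obtain N :: nat where N: "t / d < N" using reals_Archimedean2 by blast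
  have "norm (1 / n * (\<Sum>k<n. f (t * real k / real n)) - x / t) < r" if n: "n \<ge> N" for n :: nat
  proof -
    have "t / d < n" using N n by linarith
    moreover have "0 < t / d" using assms d by simp
    ultimately have "0 < real n" by linarith
    hence "0 < n" "t / n < d" using \<open>t / d < n\<close> d by (auto simp: divide_less_eq mult.commute)
    have "\<bar>x / t - 1 / n * (\<Sum>k<n. f (t * real k / real n))\<bar> \<le> r / 2"
    proof (rule riemann_sum_error[OF f(1) f(2) \<open>0 < n\<close>])
      fix s s' assume s: "s \<in> {0..t}" "s' \<in> {0..t}" "\<bar>s - s'\<bar> \<le> t / n"
      hence "dist s s' < d" using \<open>t / n < d\<close> by (simp add: dist_real_def)
      from d(2)[OF s(2,1) this] show "\<bar>f s - f s'\<bar> \<le> r / 2" by (simp add: dist_real_def)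
    qed (use r in simp)
    thus ?thesis unfolding real_norm_def using r by linarith
  qed
  thus "\<exists>N. \<forall>n\<ge>N. norm (1 / real n * (\<Sum>k<n. f (t * real k / real n)) - x / t) < r" by blast
qed

lemma abs_cos_diff_le: "\<bar>cos x - cos y\<bar> \<le> \<bar>x - y :: real\<bar>"
proof -
  have "\<bar>cos x - cos y\<bar> = 2 * (\<bar>sin ((x + y) / 2)\<bar> * \<bar>sin ((y - x) / 2)\<bar>)"
    by (simp add: cos_diff_cos abs_mult)
  also have "\<bar>sin ((x + y) / 2)\<bar> * \<bar>sin ((y - x) / 2)\<bar> \<le> 1 * \<bar>(y - x) / 2\<bar>"
    by (intro mult_mono abs_sin_le_one abs_sin_x_le_abs_x) auto
  finally show ?thesis by simp
qed

lemma abs_sin_diff_le: "\<bar>sin x - sin y\<bar> \<le> \<bar>x - y :: real\<bar>"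
  using abs_cos_diff_le[of "pi / 2 - x" "pi / 2 - y"]
  by (simp add: cos_diff)

text \<open>Rewrites a coarse Riemann sum on a refined grid: \<open>j div m\<close> is the coarse
  cell of the fine index \<open>j\<close>.\<close>

lemma sum_div_eq: "0 < m \<Longrightarrow> (\<Sum>j<n * m. h (j div m)) = real m * (\<Sum>k<n. h k)" for m n :: nat
proof -
  assume m: "0 < m"
  have "(\<Sum>j<n * m. h (j div m)) = (\<Sum>k<n. \<Sum>j = k * m..<k * m + m. h (j div m))"
    by (rule sum.nat_group[symmetric])
  also have "\<dots> = (\<Sum>k<n. \<Sum>j = k * m..<k * m + m. h k)"
  proof (intro sum.cong refl)
    fix k j assume "j \<in> {k * m..<k * m + m}"
    hence "j div m = k" using m by (intro div_nat_eqI) (auto simp: mult.commute)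
    thus "h (j div m) = h k" by simp
  qed
  finally show ?thesis by (simp add: sum_distrib_left)
qed

lemma exp_average_le:
  fixes d :: "nat \<Rightarrow> real"
  assumes "0 < N"
  shows "exp (l * (1 / N * (\<Sum>j<N. d j))) \<le> 1 / N * (\<Sum>j<N. exp (l * d j))"
proof -
  have "exp (\<Sum>j<N. (1 / N) *\<^sub>R (l * d j)) \<le> (\<Sum>j<N. 1 / N * exp (l * d j))"
    using assms by (intro convex_on_sum[OF _ _ exp_convex]) auto
  thus ?thesis by (simp add: sum_distrib_left sum_divide_distrib mult_ac)
qed

section \<open>Exponential bound for the sampling error of Brownian paths\<close>

context standard_brownian_motion
begin

text \<open>Fine times that are also coarse times give \<open>s = s'\<close>, where the increment is
  0 and not normal; the factor 2 leaves room for that case.\<close>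

lemma nn_integral_exp_increment_le:
  assumes "0 \<le> s" "s \<le> s'" "s' - s \<le> v"
  shows "(\<integral>\<^sup>+\<omega>. ennreal (exp (l * \<bar>W s' \<omega> - W s \<omega>\<bar>)) \<partial>M) \<le> ennreal (2 * exp (l\<^sup>2 * v / 2))"
proof (cases "s = s'")
  case True
  have "1 \<le> exp (l\<^sup>2 * v / 2)" using assms True by simp
  hence "1 \<le> 2 * exp (l\<^sup>2 * v / 2)" by linarith
  thus ?thesis using True by (simp add: emeasure_space_1 del: one_le_exp_iff)
next
  case False
  hence lt: "s < s'" using assms by simp
  have "(\<integral>\<^sup>+\<omega>. ennreal (exp (l * \<bar>W s' \<omega> - W s \<omega>\<bar>)) \<partial>M) \<le> ennreal (2 * exp (l\<^sup>2 * (sqrt (s' - s))\<^sup>2 / 2))"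
    using lt assms by (intro normal_nn_integral_exp_abs_le normal_increments) auto
  also have "\<dots> \<le> ennreal (2 * exp (l\<^sup>2 * v / 2))"
    using lt assms by (intro ennreal_leI) (auto intro!: mult_left_mono divide_right_mono)
  finally show ?thesis .
qed

text \<open>
  Jensen's inequality for \<open>exp\<close> reduces the exponential moment of the averaged error to that of single
  increments, so no maximal inequality is needed. Letting \<open>m \<longlongrightarrow> \<infinity>\<close> in the refined grid then
  replaces Fubini's theorem, which would need joint measurability of \<open>W\<close>.
\<close>

lemma prob_refinement_ge:
  fixes t d :: real and n m :: nat
  assumes "0 < t" "0 < n" "0 < m" "0 \<le> d"
  defines "D \<equiv> \<lambda>j \<omega>. \<bar>W (t * real j / real (n * m)) \<omega> - W (t * real (j div m) / n) \<omega>\<bar>"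
  shows "prob {\<omega> \<in> space M. d \<le> 1 / real (n * m) * (\<Sum>j<n * m. D j \<omega>)} \<le> 2 * exp (- (n * d\<^sup>2 / 2) / t)"
    (is "prob ?A \<le> _")
proof -
  define N where "N = n * m"
  have N: "0 < N" using assms by (simp add: N_def)
  \<comment> \<open>The minimiser of \<open>- l * d + l\<^sup>2 * (t / n) / 2\<close>, with minimum
    \<open>- n * d\<^sup>2 / (2 * t)\<close>.\<close>
  define l where "l = n * d / t"
  have W [measurable]: "W (t * real j / real N) \<in> borel_measurable M"
    "W (t * real j / real n) \<in> borel_measurable M" for j
    using assms by (auto intro!: random_variable_W)
  have [measurable]: "D j \<in> borel_measurable M" for j unfolding D_def N_def[symmetric] by measurable
  have D: "(\<integral>\<^sup>+\<omega>. ennreal (exp (l * D j \<omega>)) \<partial>M) \<le> ennreal (2 * exp (l\<^sup>2 * (t / n) / 2))" for j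
    unfolding D_def
  proof (rule nn_integral_exp_increment_le)
    have eq: "t * real (j div m) / n = t * real (j div m * m) / real (n * m)"
      using assms by simp
    show "t * real (j div m) / n \<le> t * real j / real (n * m)"
      unfolding eq using assms of_nat_mono[OF div_times_less_eq_dividend[of j m], where 'a = real]
      by (intro divide_right_mono mult_left_mono) simp_all
    \<comment> \<open>The fine time is \<open>j mod m\<close> fine steps after its coarse time,
      fewer than the \<open>m\<close> steps that make up \<open>t / n\<close>.\<close>
    have "j = j div m * m + j mod m" by simp
    hence rj: "real j = real (j div m * m) + real (j mod m)" using of_nat_add by metis
    hence "t * real j / real (n * m) - t * real (j div m) / n = t * real (j mod m) / real (n * m)"
      unfolding eq by (subst rj, simp only: distrib_left add_divide_distrib)
    also have "\<dots> \<le> t * real m / real (n * m)"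
      using assms by (intro divide_right_mono mult_left_mono) (auto simp: less_imp_le)
    also have "\<dots> = t / n" using assms by simp
    finally show "t * real j / real (n * m) - t * real (j div m) / n \<le> t / n" .
  qed (use assms in auto)
  have pw: "indicator ?A \<omega> \<le> ennreal (exp (- (l * d)) * (1 / N)) * (\<Sum>j<N. ennreal (exp (l * D j \<omega>)))" for \<omega>
  proof (cases "\<omega> \<in> ?A")
    case True
    have "l * d \<le> l * (1 / N * (\<Sum>j<N. D j \<omega>))"
      using True assms by (intro mult_left_mono) (auto simp: l_def N_def)
    hence "1 \<le> exp (- (l * d)) * exp (l * (1 / N * (\<Sum>j<N. D j \<omega>)))"
      by (simp add: mult_exp_exp)
    also have "\<dots> \<le> exp (- (l * d)) * (1 / N * (\<Sum>j<N. exp (l * D j \<omega>)))"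
      using exp_average_le[OF N] by (intro mult_left_mono) auto
    finally have "ennreal 1 \<le> ennreal (exp (- (l * d)) * (1 / N) * (\<Sum>j<N. exp (l * D j \<omega>)))"
      by (intro ennreal_leI) (simp add: mult_ac)
    also have "\<dots> = ennreal (exp (- (l * d)) * (1 / N)) * (\<Sum>j<N. ennreal (exp (l * D j \<omega>)))"
      by (subst sum_ennreal) (auto simp: sum_nonneg simp flip: ennreal_mult)
    finally show ?thesis using True by simp
  qed auto
  have A: "?A \<in> sets M" by measurable
  have "emeasure M ?A = (\<integral>\<^sup>+\<omega>. indicator ?A \<omega> \<partial>M)" using A by simp
  also have "\<dots> \<le> (\<integral>\<^sup>+\<omega>. ennreal (exp (- (l * d)) * (1 / N)) * (\<Sum>j<N. ennreal (exp (l * D j \<omega>))) \<partial>M)"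
    using pw by (intro nn_integral_mono)
  also have "\<dots> = ennreal (exp (- (l * d)) * (1 / N)) * (\<Sum>j<N. \<integral>\<^sup>+\<omega>. ennreal (exp (l * D j \<omega>)) \<partial>M)"
    by (subst nn_integral_cmult) (auto simp: nn_integral_sum simp del: sum_ennreal)
  also have "\<dots> \<le> ennreal (exp (- (l * d)) * (1 / N)) * (\<Sum>j<N. ennreal (2 * exp (l\<^sup>2 * (t / n) / 2)))"
    by (intro mult_left_mono sum_mono D) auto
  also have "\<dots> = ennreal (exp (- (l * d)) * (1 / N) * (N * (2 * exp (l\<^sup>2 * (t / n) / 2))))"
    by (subst sum_ennreal) (simp_all flip: ennreal_mult)
  also have "exp (- (l * d)) * (1 / N) * (N * (2 * exp (l\<^sup>2 * (t / n) / 2))) =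
     2 * exp (- (l * d) + l\<^sup>2 * (t / n) / 2)"
    unfolding exp_add using N by simp
  also have "- (l * d) + l\<^sup>2 * (t / n) / 2 = - (n * d\<^sup>2 / 2) / t"
    using assms by (simp add: l_def field_simps power2_eq_square)
  finally show ?thesis by (simp add: emeasure_eq_measure)
qed

text \<open>Since \<open>g\<close> is 1-Lipschitz, the difference of the fine and the coarse sum is
  at most the averaged displacement \<open>D\<close>. On continuous paths the fine sums converge to
  the integral, so almost surely the event lies in an increasing union of events that all obey the
  same bound.\<close>

lemma prob_riemann_sum_error_gt:
  fixes g :: "real \<Rightarrow> real" and n :: nat and t d :: real
  assumes g: "\<And>x y. \<bar>g x - g y\<bar> \<le> \<bar>x - y\<bar>"
    and X: "X \<in> borel_measurable M"
    and int: "AE \<omega> in M. ((\<lambda>s. g (W s \<omega> - W 0 \<omega>)) has_integral X \<omega>) {0..t}"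
    and "0 < t" "0 < n" "0 \<le> d"
  shows "prob {\<omega> \<in> space M. d < \<bar>X \<omega> / t - 1 / n * (\<Sum>k<n. g (W (t * real k / real n) \<omega> - W 0 \<omega>))\<bar>}
    \<le> 2 * exp (- (n * d\<^sup>2 / 2) / t)" (is "prob ?A \<le> ?b")
proof -
  let ?R = "\<lambda>n \<omega>. 1 / real n * (\<Sum>k<n. g (W (t * real k / real n) \<omega> - W 0 \<omega>))"
  define D where "D m j \<omega> = \<bar>W (t * real j / real (n * m)) \<omega> - W (t * real (j div m) / n) \<omega>\<bar>" for m j \<omega>
  \<comment> \<open>Requiring the bound for all \<open>m \<ge> M0\<close> makes \<open>B\<close>
    increasing; \<open>Suc m\<close> excludes the empty grid.\<close>
  define B where "B M0 = {\<omega> \<in> space M. \<forall>m\<ge>M0. d \<le> 1 / real (n * Suc m) * (\<Sum>j<n * Suc m. D (Suc m) j \<omega>)}" for M0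
  have [measurable]: "W (t * real j / real N) \<in> borel_measurable M" for j N
    using assms by (auto intro!: random_variable_W)
  have [measurable]: "D m j \<in> borel_measurable M" for m j unfolding D_def by measurable
  have B_meas [measurable]: "B M0 \<in> events" for M0 unfolding B_def by measurable
  have B: "prob (B M0) \<le> ?b" for M0
  proof -
    have "prob (B M0) \<le> prob {\<omega> \<in> space M. d \<le> 1 / real (n * Suc M0) * (\<Sum>j<n * Suc M0. D (Suc M0) j \<omega>)}"
      by (intro finite_measure_mono) (auto simp: B_def simp del: mult_Suc_right of_nat_Suc)
    also have "\<dots> \<le> ?b" unfolding D_def using assms by (intro prob_refinement_ge) auto
    finally show ?thesis .
  qed
  have "incseq B" by (auto simp: incseq_def B_def)
  hence "(\<lambda>i. prob (B i)) \<longlonglongrightarrow> prob (\<Union>i. B i)"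
    using B_meas by (intro finite_Lim_measure_incseq) auto
  hence U: "prob (\<Union>i. B i) \<le> ?b" using B by (intro LIMSEQ_le_const2) auto
  have "AE \<omega> in M. \<omega> \<in> ?A \<longrightarrow> \<omega> \<in> (\<Union>i. B i)"
    using int continuous_paths AE_space
  proof eventually_elim
    case (elim \<omega>)
    show ?case
    proof
      assume A: "\<omega> \<in> ?A"
      have g_cont: "continuous_on UNIV g"
        using g by (intro lipschitz_on_continuous_on[of 1] lipschitz_onI) (auto simp: dist_real_def)
      have "continuous_on {0..t} (\<lambda>s. g (W s \<omega> - W 0 \<omega>))"
        using elim by (intro continuous_on_compose2[OF g_cont] continuous_intros)
          (auto intro: continuous_on_subset)
      from riemann_sum_tendsto[OF elim(1) \<open>0 < t\<close> this]
      have "(\<lambda>N. ?R N \<omega>) \<longlonglongrightarrow> X \<omega> / t" .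
      moreover have "strict_mono (\<lambda>m. n * Suc m)" using \<open>0 < n\<close> by (auto simp: strict_mono_def)
      ultimately have "((\<lambda>N. ?R N \<omega>) \<circ> (\<lambda>m. n * Suc m)) \<longlonglongrightarrow> X \<omega> / t" by (rule LIMSEQ_subseq_LIMSEQ)
      hence "(\<lambda>m. \<bar>?R (n * Suc m) \<omega> - ?R n \<omega>\<bar>) \<longlonglongrightarrow> \<bar>X \<omega> / t - ?R n \<omega>\<bar>"
        unfolding o_def by (intro tendsto_intros)
      \<comment> \<open>The strict inequality in the event is what passes from the limit to almost
        all refinements.\<close>
      hence "\<forall>\<^sub>F m in sequentially. d < \<bar>?R (n * Suc m) \<omega> - ?R n \<omega>\<bar>"
        using A by (intro order_tendstoD) auto
      then obtain M0 where M0: "\<And>m. m \<ge> M0 \<Longrightarrow> d < \<bar>?R (n * Suc m) \<omega> - ?R n \<omega>\<bar>"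
        unfolding eventually_sequentially by blast
      have refine: "\<bar>?R (n * m) \<omega> - ?R n \<omega>\<bar> \<le> 1 / real (n * m) * (\<Sum>j<n * m. D m j \<omega>)" if m: "0 < m" for m
      proof -
        let ?h = "\<lambda>k. g (W (t * real k / n) \<omega> - W 0 \<omega>)"
        have "?R n \<omega> = 1 / real (n * m) * (\<Sum>j<n * m. ?h (j div m))"
          using m \<open>0 < n\<close> by (subst sum_div_eq) auto
        hence "\<bar>?R (n * m) \<omega> - ?R n \<omega>\<bar> = 1 / real (n * m) *
          \<bar>\<Sum>j<n * m. g (W (t * real j / real (n * m)) \<omega> - W 0 \<omega>) - ?h (j div m)\<bar>"
          by (simp add: sum_subtractf abs_divide flip: diff_divide_distrib)
        also have "\<dots> \<le> 1 / real (n * m) * (\<Sum>j<n * m. D m j \<omega>)"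
        proof (intro mult_left_mono order.trans[OF sum_abs] sum_mono)
          fix j
          show "\<bar>g (W (t * real j / real (n * m)) \<omega> - W 0 \<omega>) - ?h (j div m)\<bar> \<le> D m j \<omega>"
            using g[of "W (t * real j / real (n * m)) \<omega> - W 0 \<omega>" "W (t * real (j div m) / n) \<omega> - W 0 \<omega>"]
            by (simp add: D_def)
        qed simp
        finally show ?thesis .
      qed
      have "d \<le> 1 / real (n * Suc m) * (\<Sum>j<n * Suc m. D (Suc m) j \<omega>)" if "M0 \<le> m" for m
        by (rule less_imp_le[OF order.strict_trans2[OF M0[OF that] refine[OF zero_less_Suc]]])
      hence "\<omega> \<in> B M0" using elim(3) by (simp add: B_def del: of_nat_mult of_nat_Suc mult_Suc_right)
      thus "\<omega> \<in> (\<Union>i. B i)" by blast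
    qed
  qed
  hence "prob ?A \<le> prob (\<Union>i. B i)"
    by (intro finite_measure_mono_AE) auto
  with U show ?thesis by linarith
qed

end

section \<open>The mesoscopic rate\<close>

text \<open>Left Riemann sums: the empty partial sum at \<open>k = 0\<close> encodes the initial
  angle 0, and the last increment enters only the final angle.\<close>

definition grid_point :: "nat \<Rightarrow> (nat \<Rightarrow> real) \<Rightarrow> R3" where
  "grid_point n a =
    (1 / real n * (\<Sum>k<n. cos (\<Sum>i<k. a i)), 1 / real n * (\<Sum>k<n. sin (\<Sum>i<k. a i)), \<Sum>i<n. a i)"

definition grid_energy :: "nat \<Rightarrow> (nat \<Rightarrow> real) \<Rightarrow> real" where
  "grid_energy n a = real n / 2 * (\<Sum>i<n. (a i)\<^sup>2)"

text \<open>One \<open>C\<close> has to serve all \<open>d\<close> and \<open>N\<close>. Arbitrarily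
  fine grids are demanded because only they have a sampling error of large exponent.\<close>

definition finite_action :: "R3 \<Rightarrow> bool" where
  "finite_action q \<longleftrightarrow> (\<exists>C. \<forall>d>0. \<forall>N. \<exists>n\<ge>N. \<exists>a. grid_point n a \<in> ball q d \<and> grid_energy n a \<le> C)"

lemma dist_R3_le:
  fixes x y z x' y' z' :: real
  shows "dist (x, y, z) (x', y', z') \<le> \<bar>x - x'\<bar> + \<bar>y - y'\<bar> + \<bar>z - z'\<bar>"
  using norm_Pair_le[of "x - x'" "(y - y', z - z')"] norm_Pair_le[of "y - y'" "z - z'"]
  by (simp add: dist_norm)

lemma dist_R3_ge:
  fixes x y z x' y' z' :: real
  shows "\<bar>x - x'\<bar> \<le> dist (x, y, z) (x', y', z')" "\<bar>y - y'\<bar> \<le> dist (x, y, z) (x', y', z')"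
    "\<bar>z - z'\<bar> \<le> dist (x, y, z) (x', y', z')"
  using dist_fst_le[of "(x, y, z)" "(x', y', z')"]
    dist_snd_le[of "(x, y, z)" "(x', y', z')"] dist_fst_le[of "(y, z)" "(y', z')"] dist_snd_le[of "(y, z)" "(y', z')"]
  by (auto simp: dist_real_def)

text \<open>Every partial sum moves by at most \<open>n * h\<close>; the factor 3 counts the
  coordinates.\<close>

lemma grid_point_near:
  assumes "0 < n" and h: "\<And>i. i < n \<Longrightarrow> \<bar>b i - a i\<bar> \<le> h"
  shows "dist (grid_point n b) (grid_point n a) \<le> 3 * (real n * h)"
proof -
  have "0 \<le> h" using h[OF \<open>0 < n\<close>] by linarith
  have S: "\<bar>(\<Sum>i<k. b i) - (\<Sum>i<k. a i)\<bar> \<le> real n * h" if "k \<le> n" for k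
  proof -
    have "\<bar>(\<Sum>i<k. b i) - (\<Sum>i<k. a i)\<bar> \<le> (\<Sum>i<k. \<bar>b i - a i\<bar>)"
      by (simp add: sum_abs flip: sum_subtractf)
    also have "\<dots> \<le> (\<Sum>i<k. h)" using h that by (intro sum_mono) auto
    also have "\<dots> \<le> real n * h" using that \<open>0 \<le> h\<close> by (simp add: mult_right_mono)
    finally show ?thesis .
  qed
  have g: "\<bar>1 / real n * (\<Sum>k<n. g (\<Sum>i<k. b i)) - 1 / real n * (\<Sum>k<n. g (\<Sum>i<k. a i))\<bar> \<le> real n * h"
    if "\<And>x y. \<bar>g x - g y\<bar> \<le> \<bar>x - y\<bar>" for g :: "real \<Rightarrow> real"
  proof -
    have "\<bar>1 / real n * (\<Sum>k<n. g (\<Sum>i<k. b i)) - 1 / real n * (\<Sum>k<n. g (\<Sum>i<k. a i))\<bar> =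
      1 / real n * \<bar>\<Sum>k<n. g (\<Sum>i<k. b i) - g (\<Sum>i<k. a i)\<bar>"
      by (simp add: sum_subtractf abs_divide flip: diff_divide_distrib)
    also have "\<dots> \<le> 1 / real n * (\<Sum>k<n. real n * h)"
      by (intro mult_left_mono order.trans[OF sum_abs] sum_mono order.trans[OF that S]) auto
    also have "\<dots> = real n * h" using \<open>0 < n\<close> by simp
    finally show ?thesis .
  qed
  show ?thesis unfolding grid_point_def
    using order.trans[OF dist_R3_le add_mono[OF add_mono[OF g[of cos] g[of sin]] S[of n]]]
    by (simp add: abs_cos_diff_le abs_sin_diff_le mult_ac)
qed

section \<open>Local exponential rates of the rescaled solution\<close>

locale sde_solution = standard_brownian_motion +
  fixes p :: "real \<Rightarrow> 'a \<Rightarrow> R3"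
  assumes solves: "solves_sde M W p"
begin

definition meso :: "real \<Rightarrow> 'a \<Rightarrow> R3" where
  "meso t \<omega> = mesoscopic_scale t (p t \<omega>)"

text \<open>The exponent \<open>c = 0\<close> is always admissible, as probabilities are at most 1;
  unbounded exponents give the value \<open>\<infinity>\<close>.\<close>

definition meso_rate :: "R3 \<Rightarrow> ennreal" where
  "meso_rate q = (SUP c\<in>{c. 0 \<le> c \<and> (\<exists>d>0. exp_upper (\<lambda>t. prob {\<omega> \<in> space M. meso t \<omega> \<in> ball q d}) c)}. ennreal c)"

lemma random_variable_p [measurable]: "0 \<le> t \<Longrightarrow> p t \<in> borel_measurable M"
  using solves by (simp add: solves_sde_def)

lemma meso_eq: "meso t \<omega> = (fst (p t \<omega>) / t, fst (snd (p t \<omega>)) / t, snd (snd (p t \<omega>)))"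
  by (cases "p t \<omega>") (simp add: meso_def mesoscopic_scale_def)

lemma random_variable_meso [measurable]: "0 \<le> t \<Longrightarrow> meso t \<in> borel_measurable M"
  unfolding meso_eq[abs_def] divide_inverse
  by (intro measurable_compose[OF random_variable_p borel_measurable_continuous_onI] continuous_intros)

lemma meso_events: "0 \<le> t \<Longrightarrow> A \<in> sets borel \<Longrightarrow> {\<omega> \<in> space M. meso t \<omega> \<in> A} \<in> events"
  using measurable_sets[OF random_variable_meso, of t A] by (simp add: vimage_def Int_def conj_commute)

lemma solution_AE:
  assumes "0 < t"
  shows "AE \<omega> in M.
    ((\<lambda>s. cos (W s \<omega> - W 0 \<omega>)) has_integral fst (p t \<omega>)) {0..t} \<and>
    ((\<lambda>s. sin (W s \<omega> - W 0 \<omega>)) has_integral fst (snd (p t \<omega>))) {0..t} \<and>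
    snd (snd (p t \<omega>)) = W t \<omega> - W 0 \<omega> \<and>
    \<bar>fst (p t \<omega>)\<bar> \<le> t \<and> \<bar>fst (snd (p t \<omega>))\<bar> \<le> t"
proof -
  have "AE \<omega> in M. \<forall>t\<ge>0. case p t \<omega> of (x, y, \<phi>) \<Rightarrow>
        ((\<lambda>s. cos (snd (snd (p s \<omega>)))) has_integral x) {0..t} \<and>
        ((\<lambda>s. sin (snd (snd (p s \<omega>)))) has_integral y) {0..t} \<and>
        \<phi> = W t \<omega> - W 0 \<omega>"
    using solves by (auto simp: solves_sde_def)
  thus ?thesis
  proof eventually_elim
    case (elim \<omega>)
    have \<phi>: "snd (snd (p s \<omega>)) = W s \<omega> - W 0 \<omega>" if "0 \<le> s" for s
      using elim that by (auto simp: case_prod_unfold)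
    have x: "((\<lambda>s. cos (snd (snd (p s \<omega>)))) has_integral fst (p t \<omega>)) {0..t}"
      and y: "((\<lambda>s. sin (snd (snd (p s \<omega>)))) has_integral fst (snd (p t \<omega>))) {0..t}"
      using elim assms by (auto simp: case_prod_unfold)
    have "((\<lambda>s. cos (W s \<omega> - W 0 \<omega>)) has_integral fst (p t \<omega>)) {0..t}"
      by (rule has_integral_eq[OF _ x]) (simp add: \<phi>)
    moreover have "((\<lambda>s. sin (W s \<omega> - W 0 \<omega>)) has_integral fst (snd (p t \<omega>))) {0..t}"
      by (rule has_integral_eq[OF _ y]) (simp add: \<phi>)
    moreover have "\<bar>fst (p t \<omega>)\<bar> \<le> t" "\<bar>fst (snd (p t \<omega>))\<bar> \<le> t"
      using has_integral_bound_real[OF _ _ x, of 1 "{}"] has_integral_bound_real[OF _ _ y, of 1 "{}"] assms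
      by auto
    ultimately show ?case using \<phi>[of t] assms by simp
  qed
qed

lemma sum_increment: "0 < n \<Longrightarrow> (\<Sum>i<k. increment t n i \<omega>) = W (t * real k / real n) \<omega> - W 0 \<omega>"
  unfolding increment_def
  using sum_lessThan_telescope[of "\<lambda>i. W (t * real i / real n) \<omega>" k] by simp

lemma random_variable_grid_point [measurable]:
  "0 \<le> t \<Longrightarrow> (\<lambda>\<omega>. grid_point n (\<lambda>i. increment t n i \<omega>)) \<in> borel_measurable M"
  unfolding grid_point_def by measurable

lemma random_variable_grid_energy [measurable]:
  "0 \<le> t \<Longrightarrow> (\<lambda>\<omega>. grid_energy n (\<lambda>i. increment t n i \<omega>)) \<in> borel_measurable M"
  unfolding grid_energy_def by measurable

text \<open>One \<open>d\<close> each for the cosine and the sine coordinate; the angle is almost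
  surely reproduced exactly by the grid.\<close>

lemma exp_upper_grid_error:
  assumes n: "0 < n" and "0 < d" and c: "c < real n * d\<^sup>2 / 2"
  shows "exp_upper (\<lambda>t. prob {\<omega> \<in> space M. 2 * d < dist (meso t \<omega>) (grid_point n (\<lambda>i. increment t n i \<omega>))}) c"
proof -
  let ?E = "\<lambda>g X t. {\<omega> \<in> space M. d < \<bar>X (p t \<omega>) / t - 1 / real n * (\<Sum>k<n. g (W (t * real k / real n) \<omega> - W 0 \<omega>))\<bar>}"
  let ?A = "\<lambda>t. {\<omega> \<in> space M. 2 * d < dist (meso t \<omega>) (grid_point n (\<lambda>i. increment t n i \<omega>))}"
  have bound: "prob (?A t) \<le> 4 * exp (- (real n * d\<^sup>2 / 2) / t)" if t: "0 < t" for t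
  proof -
    have [measurable]: "W (t * real j / real n) \<in> borel_measurable M" "W 0 \<in> borel_measurable M" for j
      using t by (auto intro!: random_variable_W)
    have X [measurable]: "(\<lambda>\<omega>. fst (p t \<omega>)) \<in> borel_measurable M" "(\<lambda>\<omega>. fst (snd (p t \<omega>))) \<in> borel_measurable M"
      using t by (auto intro!: measurable_compose[OF random_variable_p borel_measurable_continuous_onI] continuous_intros)
    have [measurable]: "?E cos fst t \<in> events" "?E sin (\<lambda>z. fst (snd z)) t \<in> events" by measurable
    have c: "prob (?E cos fst t) \<le> 2 * exp (- (real n * d\<^sup>2 / 2) / t)"
      using solution_AE[OF t] t n assms X
      by (intro prob_riemann_sum_error_gt) (auto simp: abs_cos_diff_le)
    have s: "prob (?E sin (\<lambda>z. fst (snd z)) t) \<le> 2 * exp (- (real n * d\<^sup>2 / 2) / t)"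
      using solution_AE[OF t] t n assms X
      by (intro prob_riemann_sum_error_gt) (auto simp: abs_sin_diff_le)
    have "prob (?A t) \<le> prob (?E cos fst t \<union> ?E sin (\<lambda>z. fst (snd z)) t)"
    proof (rule finite_measure_mono_AE)
      show "AE \<omega> in M. \<omega> \<in> ?A t \<longrightarrow> \<omega> \<in> ?E cos fst t \<union> ?E sin (\<lambda>z. fst (snd z)) t"
        using solution_AE[OF t]
      proof eventually_elim
        case (elim \<omega>)
        have "dist (meso t \<omega>) (grid_point n (\<lambda>i. increment t n i \<omega>)) \<le>
          \<bar>fst (p t \<omega>) / t - 1 / real n * (\<Sum>k<n. cos (W (t * real k / real n) \<omega> - W 0 \<omega>))\<bar> +
          \<bar>fst (snd (p t \<omega>)) / t - 1 / real n * (\<Sum>k<n. sin (W (t * real k / real n) \<omega> - W 0 \<omega>))\<bar> + 0"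
          unfolding meso_eq grid_point_def sum_increment[OF n]
          by (rule order.trans[OF dist_R3_le]) (use elim n in simp)
        thus ?case by auto
      qed
    qed measurable
    also have "\<dots> \<le> prob (?E cos fst t) + prob (?E sin (\<lambda>z. fst (snd z)) t)"
      by (rule measure_Un_le) measurable
    finally show ?thesis using c s by linarith
  qed
  show ?thesis
    unfolding exp_upper_def
    using eventually_mult_exp_le[OF c, of 4] eventually_at_right_0_pos
  proof eventually_elim
    case (elim t)
    thus ?case using bound[of t] by (simp add: mult.commute)
  qed
qed

text \<open>If \<open>meso t\<close> is in the ball, either the sampling error exceeds
  \<open>2 * d\<close>, or the grid point lies in the enlarged ball and then its energy is at least
  \<open>m\<close>.\<close>

lemma exp_upper_meso_ball:
  assumes n: "0 < n" and "0 < d"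
    and m: "\<And>a. grid_point n a \<in> ball q (r + 2 * d) \<Longrightarrow> m \<le> grid_energy n a"
    and c: "c < m" "c < real n * d\<^sup>2 / 2"
  shows "exp_upper (\<lambda>t. prob {\<omega> \<in> space M. meso t \<omega> \<in> ball q r}) c"
proof -
  let ?G = "\<lambda>t \<omega>. (\<lambda>i. increment t n i \<omega>)"
  let ?E = "\<lambda>t. {\<omega> \<in> space M. m \<le> grid_energy n (?G t \<omega>)}"
  let ?D = "\<lambda>t. {\<omega> \<in> space M. 2 * d < dist (meso t \<omega>) (grid_point n (?G t \<omega>))}"
  obtain c' where c': "c < c'" "c' < m" "c' < real n * d\<^sup>2 / 2"
    using c dense[of c "min m (real n * d\<^sup>2 / 2)"] by auto
  have "exp_upper (\<lambda>t. prob (?E t) + prob (?D t)) c"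
    unfolding grid_energy_def using c' assms
    by (intro exp_upper_add[OF exp_upper_energy exp_upper_grid_error c'(1)]) auto
  thus ?thesis
  proof (rule exp_upper_mono)
    show "\<forall>\<^sub>F t in at_right 0. prob {\<omega> \<in> space M. meso t \<omega> \<in> ball q r} \<le> prob (?E t) + prob (?D t)"
      using eventually_at_right_0_pos
    proof eventually_elim
      case (elim t)
      have [measurable]: "meso t \<in> borel_measurable M"
        "(\<lambda>\<omega>. grid_point n (?G t \<omega>)) \<in> borel_measurable M"
        "(\<lambda>\<omega>. grid_energy n (?G t \<omega>)) \<in> borel_measurable M"
        using elim by (auto intro: random_variable_meso random_variable_grid_point random_variable_grid_energy)
      have [measurable]: "?E t \<in> events" "?D t \<in> events" by measurable
      have "prob {\<omega> \<in> space M. meso t \<omega> \<in> ball q r} \<le> prob (?E t \<union> ?D t)"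
      proof (rule finite_measure_mono)
        show "{\<omega> \<in> space M. meso t \<omega> \<in> ball q r} \<subseteq> ?E t \<union> ?D t"
        proof safe
          fix \<omega> assume *: "\<omega> \<in> space M" "meso t \<omega> \<in> ball q r"
            and "\<not> 2 * d < dist (meso t \<omega>) (grid_point n (?G t \<omega>))"
          hence "grid_point n (?G t \<omega>) \<in> ball q (r + 2 * d)"
            using dist_triangle[of q "grid_point n (?G t \<omega>)" "meso t \<omega>"] by simp
          thus "m \<le> grid_energy n (?G t \<omega>)" by (rule m)
        qed
      qed measurable
      also have "\<dots> \<le> prob (?E t) + prob (?D t)" by (rule measure_Un_le) measurable
      finally show ?case .
    qed
  qed simp
qed

text \<open>Increments close to \<open>a\<close> keep the grid point in the ball of radius
  \<open>r\<close>, and the solution is within \<open>2 * d\<close> of it outside an error event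
  whose exponent exceeds \<open>c\<close>.\<close>

lemma exp_lower_meso_ball:
  assumes n: "0 < n" and "0 < d"
    and a: "grid_point n a \<in> ball q r" "grid_energy n a < c"
    and c: "c < real n * d\<^sup>2 / 2"
  shows "exp_lower (\<lambda>t. prob {\<omega> \<in> space M. meso t \<omega> \<in> ball q (r + 2 * d)}) c"
proof -
  let ?G = "\<lambda>t \<omega>. (\<lambda>i. increment t n i \<omega>)"
  \<comment> \<open>By \<open>grid_point_near\<close> the displacement is at most
    \<open>3 * (real n * h)\<close>, half the distance to the boundary of the ball.\<close>
  define h where "h = (r - dist q (grid_point n a)) / (6 * real n)"
  have h: "0 < h" using a n by (simp add: h_def)
  let ?E = "\<lambda>t. {\<omega> \<in> space M. \<forall>i<n. \<bar>increment t n i \<omega> - a i\<bar> < h}"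
  let ?D = "\<lambda>t. {\<omega> \<in> space M. 2 * d < dist (meso t \<omega>) (grid_point n (?G t \<omega>))}"
  let ?B = "\<lambda>t. {\<omega> \<in> space M. meso t \<omega> \<in> ball q (r + 2 * d)}"
  obtain c' where c': "grid_energy n a < c'" "c' < c" using a(2) dense by blast
  have "exp_lower (\<lambda>t. prob (?E t) - prob (?D t)) c"
    using c' assms h unfolding grid_energy_def
    by (intro exp_lower_diff[OF exp_lower_increments exp_upper_grid_error c'(2) c'(2)]) auto
  thus ?thesis
  proof (rule exp_lower_mono)
    show "\<forall>\<^sub>F t in at_right 0. prob (?E t) - prob (?D t) \<le> prob (?B t)"
      using eventually_at_right_0_pos
    proof eventually_elim
      case (elim t)
      have [measurable]: "increment t n i \<in> borel_measurable M" "meso t \<in> borel_measurable M"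
        "(\<lambda>\<omega>. grid_point n (?G t \<omega>)) \<in> borel_measurable M" for i
        using elim by (auto intro: random_variable_increment random_variable_meso random_variable_grid_point)
      have [measurable]: "?E t \<in> events" "?D t \<in> events" by measurable
      have [measurable]: "?B t \<in> events" using elim by (intro meso_events) auto
      have "prob (?E t) \<le> prob (?B t \<union> ?D t)"
      proof (rule finite_measure_mono)
        show "?E t \<subseteq> ?B t \<union> ?D t"
        proof safe
          fix \<omega> assume *: "\<omega> \<in> space M" "\<forall>i<n. \<bar>increment t n i \<omega> - a i\<bar> < h"
            and D: "\<not> 2 * d < dist (meso t \<omega>) (grid_point n (?G t \<omega>))"
          have "dist (grid_point n (?G t \<omega>)) (grid_point n a) \<le> 3 * (real n * h)"
            using * n by (intro grid_point_near) (auto simp: less_imp_le)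
          also have "\<dots> = (r - dist q (grid_point n a)) / 2" using n by (simp add: h_def)
          also have "\<dots> < r - dist q (grid_point n a)" using a by simp
          finally have "dist q (grid_point n (?G t \<omega>)) < r"
            using dist_triangle[of q "grid_point n (?G t \<omega>)" "grid_point n a"]
            by (simp add: dist_commute)
          thus "meso t \<omega> \<in> ball q (r + 2 * d)"
            using D dist_triangle[of q "meso t \<omega>" "grid_point n (?G t \<omega>)"]
            by (simp add: dist_commute)
        qed
      qed measurable
      also have "\<dots> \<le> prob (?B t) + prob (?D t)" by (rule measure_Un_le) measurable
      finally show ?case by simp
    qed
  qed simp
qed

lemma meso_rate_upper:
  assumes "0 \<le> c" "ennreal c < meso_rate q"
  shows "\<exists>d>0. exp_upper (\<lambda>t. prob {\<omega> \<in> space M. meso t \<omega> \<in> ball q d}) c"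
proof -
  obtain c' d where *: "0 \<le> c'" "0 < d" "ennreal c < ennreal c'"
    "exp_upper (\<lambda>t. prob {\<omega> \<in> space M. meso t \<omega> \<in> ball q d}) c'"
    using assms unfolding meso_rate_def less_SUP_iff by auto
  hence "c \<le> c'" using assms by (simp add: ennreal_less_iff)
  thus ?thesis using * exp_upper_mono[OF *(4)] by auto
qed

lemma le_meso_rate:
  assumes "0 \<le> c" "0 < d" "exp_upper (\<lambda>t. prob {\<omega> \<in> space M. meso t \<omega> \<in> ball q d}) c"
  shows "ennreal c \<le> meso_rate q"
  unfolding meso_rate_def using assms by (intro SUP_upper) auto

lemma ex_large_grid:
  assumes "0 < (d::real)"
  shows "\<exists>n\<ge>N. 0 < n \<and> c < real n * d\<^sup>2 / 2"
proof -
  obtain k :: nat where k: "2 * c / d\<^sup>2 < real k" using reals_Archimedean2 by blast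
  define n where "n = Suc (max N k)"
  have "2 * c / d\<^sup>2 < real n" using k by (simp add: n_def)
  hence "c < real n * d\<^sup>2 / 2" using assms by (simp add: divide_less_eq)
  thus ?thesis by (intro exI[of _ n]) (auto simp: n_def)
qed

text \<open>The contrapositive of \<open>exp_upper_meso_ball\<close>: without such a path,
  \<open>c' > meso_rate q\<close> would be an admissible exponent. \<open>K\<close> lets the caller
  make the same grid fine enough for a lower bound.\<close>

lemma ex_grid_point:
  assumes "0 \<le> c" "meso_rate q < ennreal c" "0 < d"
  shows "\<exists>n\<ge>N. 0 < n \<and> K < real n * d\<^sup>2 \<and> (\<exists>a. grid_point n a \<in> ball q d \<and> grid_energy n a < c)"
proof -
  obtain s where s: "meso_rate q < s" "s < ennreal c" using assms(2) dense by blast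
  then obtain c' where c': "0 \<le> c'" "s = ennreal c'" by (cases s) auto
  have lt: "c' < c" using s c' by (simp add: ennreal_less_iff)
  \<comment> \<open>With \<open>d / 3\<close> as radius and as error parameter, the enlarged ball
    has radius exactly \<open>d\<close>.\<close>
  obtain n where n: "N \<le> n" "0 < n" "max c \<bar>K\<bar> < real n * (d / 3)\<^sup>2 / 2"
    using ex_large_grid[of "d / 3"] assms by force
  have K: "K < real n * d\<^sup>2" using n by (simp add: power_divide)
  have "\<exists>a. grid_point n a \<in> ball q d \<and> grid_energy n a < c"
  proof (rule ccontr)
    assume neg: "\<not> ?thesis"
    have "exp_upper (\<lambda>t. prob {\<omega> \<in> space M. meso t \<omega> \<in> ball q (d / 3)}) c'"
    proof (rule exp_upper_meso_ball[where n = n and d = "d / 3" and m = c])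
      fix a assume "grid_point n a \<in> ball q (d / 3 + 2 * (d / 3))"
      thus "c \<le> grid_energy n a" using neg by (fastforce simp: not_less)
    qed (use n lt assms in auto)
    hence "ennreal c' \<le> meso_rate q" using assms c' by (intro le_meso_rate[of _ "d / 3"]) auto
    thus False using s c' by simp
  qed
  with n K show ?thesis by blast
qed

lemma meso_rate_lower:
  assumes "0 < d" "0 \<le> c" "meso_rate q < ennreal c"
  shows "exp_lower (\<lambda>t. prob {\<omega> \<in> space M. meso t \<omega> \<in> ball q d}) c"
proof -
  \<comment> \<open>The radius is split as \<open>d / 2 + 2 * (d / 4)\<close>; the bound with
    \<open>32 * c\<close> more than ensures that the error with parameter \<open>d / 4\<close> has
    exponent above \<open>c\<close>.\<close>
  obtain n a where n: "0 < n" "32 * c < real n * (d / 2)\<^sup>2"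
    and a: "grid_point n a \<in> ball q (d / 2)" "grid_energy n a < c"
    using ex_grid_point[OF assms(2,3), of "d / 2" 0 "32 * c"] assms by auto
  have "c < real n * (d / 4)\<^sup>2 / 2" using n assms by (simp add: power_divide)
  from exp_lower_meso_ball[OF n(1) _ a this] assms show ?thesis by simp
qed

text \<open>From right to left, paths of bounded energy on one sufficiently fine grid give a ball
  the lower exponent \<open>c - 1\<close>, incompatible with the upper exponent
  \<open>c\<close>.\<close>

lemma meso_rate_finite_iff: "meso_rate q < \<infinity> \<longleftrightarrow> finite_action q"
proof
  assume "meso_rate q < \<infinity>"
  then obtain c where c: "0 \<le> c" "meso_rate q = ennreal c" by (cases "meso_rate q") auto
  hence lt: "meso_rate q < ennreal (c + 1)" by (simp add: ennreal_less_iff)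
  show "finite_action q"
    unfolding finite_action_def
  proof (intro exI[of _ "c + 1"] allI impI)
    fix d :: real and N assume "0 < d"
    thus "\<exists>n\<ge>N. \<exists>a. grid_point n a \<in> ball q d \<and> grid_energy n a \<le> c + 1"
      using ex_grid_point[OF _ lt, of d N 0] c by (auto simp: less_imp_le intro: less_imp_le)
  qed
next
  assume "finite_action q"
  then obtain C where C: "\<And>d N. 0 < d \<Longrightarrow> \<exists>n\<ge>N. \<exists>a. grid_point n a \<in> ball q d \<and> grid_energy n a \<le> C"
    unfolding finite_action_def by metis
  \<comment> \<open>Makes \<open>c\<close> nonnegative and leaves \<open>C < c - 1 < c\<close>, one
    gap for the energy and one for the contradiction.\<close>
  define c where "c = \<bar>C\<bar> + 2"
  have "meso_rate q \<le> ennreal c"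
  proof (rule ccontr)
    assume "\<not> ?thesis"
    then obtain d where d: "0 < d" "exp_upper (\<lambda>t. prob {\<omega> \<in> space M. meso t \<omega> \<in> ball q d}) c"
      using meso_rate_upper[of c q] by (auto simp: c_def not_le)
    obtain N where N: "0 < N" "c < real N * (d / 4)\<^sup>2 / 2"
      using ex_large_grid[of "d / 4" 0 c] d by auto
    obtain n a where n: "N \<le> n" and a: "grid_point n a \<in> ball q (d / 2)" "grid_energy n a \<le> C"
      using C[of "d / 2" N] d by auto
    have "real N * (d / 4)\<^sup>2 / 2 \<le> real n * (d / 4)\<^sup>2 / 2"
      using n by (intro divide_right_mono mult_right_mono) auto
    hence "c - 1 < real n * (d / 4)\<^sup>2 / 2" using N by linarith
    moreover have "grid_energy n a < c - 1" using a by (simp add: c_def)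
    ultimately have "exp_lower (\<lambda>t. prob {\<omega> \<in> space M. meso t \<omega> \<in> ball q (d / 2 + 2 * (d / 4))}) (c - 1)"
      using n N a d by (intro exp_lower_meso_ball[where n = n and a = a]) auto
    hence low: "exp_lower (\<lambda>t. prob {\<omega> \<in> space M. meso t \<omega> \<in> ball q d}) (c - 1)" by simp
    have "\<forall>\<^sub>F t in at_right 0. 2 * exp (- c / t) \<le> exp (- (c - 1) / t)"
      by (rule eventually_mult_exp_le) simp
    hence "\<forall>\<^sub>F t::real in at_right 0. False"
      using low d(2) unfolding exp_lower_def exp_upper_def
    proof eventually_elim
      case (elim t)
      have "0 < exp (- c / t)" by simp
      thus ?case using elim by linarith
    qed
    thus False by simp
  qed
  also have "ennreal c < \<infinity>" by simp
  finally show "meso_rate q < \<infinity>" .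
qed

text \<open>Only the angle can leave a box. It is the single increment of the grid with
  \<open>n = 1\<close>, whose energy on that event is at least
  \<open>R\<^sup>2 / 2 > c\<close>.\<close>

lemma exponentially_tight:
  fixes X :: "real \<Rightarrow> 'a \<Rightarrow> R3"
  assumes bound: "\<forall>\<^sub>F t in at_right 0. AE \<omega> in M.
      \<bar>fst (X t \<omega>)\<bar> \<le> 1 \<and> \<bar>fst (snd (X t \<omega>))\<bar> \<le> 1 \<and> snd (snd (X t \<omega>)) = W t \<omega> - W 0 \<omega>"
  shows "\<exists>K. compact K \<and> exp_upper (\<lambda>t. prob {\<omega> \<in> space M. X t \<omega> \<in> - K}) c"
proof -
  define R where "R = \<bar>c\<bar> + 2"
  have "R\<^sup>2 = \<bar>c\<bar>\<^sup>2 + 4 * \<bar>c\<bar> + 4" by (simp only: R_def power2_eq_square algebra_simps)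
  hence "2 * c < R\<^sup>2" using zero_le_power2[of "\<bar>c\<bar>"] by linarith
  hence R: "c < R\<^sup>2 / 2" "0 \<le> R" by (auto simp: R_def)
  let ?K = "cbox (-1, -1, -R) (1, 1, R) :: R3 set"
  have "exp_upper (\<lambda>t. prob {\<omega> \<in> space M. R\<^sup>2 / 2 \<le> real 1 / 2 * (\<Sum>i<1. (increment t 1 i \<omega>)\<^sup>2)}) c"
    using R by (intro exp_upper_energy) auto
  hence "exp_upper (\<lambda>t. prob {\<omega> \<in> space M. X t \<omega> \<in> - ?K}) c"
  proof (rule exp_upper_mono)
    show "\<forall>\<^sub>F t in at_right 0. prob {\<omega> \<in> space M. X t \<omega> \<in> - ?K} \<le>
      prob {\<omega> \<in> space M. R\<^sup>2 / 2 \<le> real 1 / 2 * (\<Sum>i<1. (increment t 1 i \<omega>)\<^sup>2)}"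
      using bound eventually_at_right_0_pos
    proof eventually_elim
      case (elim t)
      show ?case
      proof (rule finite_measure_mono_AE)
        show "AE \<omega> in M. \<omega> \<in> {\<omega> \<in> space M. X t \<omega> \<in> - ?K} \<longrightarrow>
          \<omega> \<in> {\<omega> \<in> space M. R\<^sup>2 / 2 \<le> real 1 / 2 * (\<Sum>i<1. (increment t 1 i \<omega>)\<^sup>2)}"
          using elim(1)
        proof eventually_elim
          case (elim \<omega>)
          obtain x y z where q: "X t \<omega> = (x, y, z)" by (cases "X t \<omega>") auto
          have inc: "increment t 1 0 \<omega> = z" using elim q by (simp add: increment_def)
          have "R\<^sup>2 \<le> z\<^sup>2" if "X t \<omega> \<notin> ?K"
          proof -
            have "R \<le> \<bar>z\<bar>" using that elim q by (auto simp: cbox_Pair_eq abs_le_iff)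
            thus ?thesis using R by (metis abs_of_nonneg abs_le_square_iff)
          qed
          thus ?case using inc by auto
        qed
        have [measurable]: "increment t 1 i \<in> borel_measurable M" for i
          using elim by (auto intro: random_variable_increment)
        show "{\<omega> \<in> space M. R\<^sup>2 / 2 \<le> real 1 / 2 * (\<Sum>i<1. (increment t 1 i \<omega>)\<^sup>2)} \<in> events"
          by measurable
      qed
    qed
  qed simp
  thus ?thesis by (intro exI[of _ ?K]) (auto simp: compact_cbox)
qed

end

section \<open>Points of finite rate\<close>

lemma abs_sin_less:
  assumes "z \<noteq> (0::real)"
  shows "\<bar>sin z\<bar> < \<bar>z\<bar>"
proof -
  have pos: "\<bar>sin z\<bar> < z" if z: "0 < z" for z :: real
  proof (cases "z \<le> 1")
    case True
    obtain v where v: "0 < v" "v < z" "sin z - sin 0 = (z - 0) * cos v"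
      using MVT2[OF z, of sin cos] by (auto intro!: DERIV_sin)
    have "cos v < cos 0" using v True pi_gt3 by (intro cos_monotone_0_pi) auto
    hence "sin z < z" using v z by simp
    moreover have "0 \<le> sin z" using z True pi_gt3 by (intro sin_ge_zero) auto
    ultimately show ?thesis by simp
  next
    case False
    thus ?thesis using abs_sin_le_one[of z] by linarith
  qed
  show ?thesis using pos[of z] pos[of "- z"] assms by (cases "z > 0") auto
qed

text \<open>The strictness makes the potential \<open>H\<close> vanish at 0 only.\<close>

lemma abs_sin_diff_less:
  assumes "x \<noteq> (y::real)"
  shows "\<bar>sin x - sin y\<bar> < \<bar>x - y\<bar>"
proof -
  have "\<bar>sin x - sin y\<bar> = 2 * (\<bar>sin ((x - y) / 2)\<bar> * \<bar>cos ((x + y) / 2)\<bar>)"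
    by (simp add: sin_diff_sin abs_mult)
  also have "\<bar>sin ((x - y) / 2)\<bar> * \<bar>cos ((x + y) / 2)\<bar> \<le> \<bar>sin ((x - y) / 2)\<bar> * 1"
    by (intro mult_left_mono abs_cos_le_one) auto
  also have "\<bar>sin ((x - y) / 2)\<bar> * 1 < \<bar>(x - y) / 2\<bar>"
    using abs_sin_less[of "(x - y) / 2"] assms by simp
  finally show ?thesis by simp
qed

text \<open>The right-hand side is the component of the displacement in direction
  \<open>\<theta>\<close>.\<close>

lemma sum_cos_shift:
  "(\<Sum>k<n. cos (s k - \<theta>)) = cos \<theta> * (\<Sum>k<n. cos (s k)) + sin \<theta> * (\<Sum>k<n. sin (s k :: real))"
  by (simp add: cos_diff sum.distrib sum_distrib_left mult.commute)

text \<open>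
  The increasing function \<open>H u = u - sin (u - \<theta>) - sin \<theta>\<close> has derivative \<open>1 - cos (u - \<theta>)\<close>.
  If the mean of \<open>1 - cos (s k - \<theta>)\<close> is small and the energy is bounded, Cauchy--Schwarz bounds the
  total variation of \<open>H\<close> along the path, so the path cannot leave a neighbourhood of \<open>0\<close>.
\<close>

lemma potential_step:
  fixes s a \<theta> :: real
  shows "\<bar>a - (sin (s + a - \<theta>) - sin (s - \<theta>))\<bar> \<le> (1 - cos (s - \<theta>)) * \<bar>a\<bar> + a\<^sup>2"
proof -
  define H where "H u = u - sin (u - \<theta>)" for u
  have D: "(H has_real_derivative (1 - cos (u - \<theta>))) (at u)" for u
    unfolding H_def by (auto intro!: derivative_eq_intros)
  \<comment> \<open>Mean value theorem on either side of \<open>s\<close>. Moving the derivative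
    from \<open>v\<close> back to \<open>s\<close> costs at most \<open>\<bar>a\<bar>\<close>,
    whence the term \<open>a\<^sup>2\<close>.\<close>
  have "\<exists>v. \<bar>v - s\<bar> \<le> \<bar>a\<bar> \<and> H (s + a) - H s = a * (1 - cos (v - \<theta>))"
  proof (cases a "0 :: real" rule: linorder_cases)
    case less
    obtain v where v: "s + a < v" "v < s" "H s - H (s + a) = (s - (s + a)) * (1 - cos (v - \<theta>))"
      using MVT2[of "s + a" s H "\<lambda>u. 1 - cos (u - \<theta>)"] D less by auto
    show ?thesis using v less by (intro exI[of _ v]) (auto simp: algebra_simps)
  next
    case equal
    then show ?thesis by (intro exI[of _ s]) auto
  next
    case greater
    obtain v where v: "s < v" "v < s + a" "H (s + a) - H s = (s + a - s) * (1 - cos (v - \<theta>))"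
      using MVT2[of s "s + a" H "\<lambda>u. 1 - cos (u - \<theta>)"] D greater by auto
    show ?thesis using v greater by (intro exI[of _ v]) auto
  qed
  then obtain v where v: "\<bar>v - s\<bar> \<le> \<bar>a\<bar>" "H (s + a) - H s = a * (1 - cos (v - \<theta>))" by blast
  have "1 - cos (v - \<theta>) \<le> (1 - cos (s - \<theta>)) + \<bar>a\<bar>"
    using abs_cos_diff_le[of "s - \<theta>" "v - \<theta>"] v(1) by linarith
  moreover have "0 \<le> 1 - cos (v - \<theta>)" by simp
  ultimately have "\<bar>a\<bar> * (1 - cos (v - \<theta>)) \<le> \<bar>a\<bar> * ((1 - cos (s - \<theta>)) + \<bar>a\<bar>)"
    by (intro mult_left_mono) auto
  hence "\<bar>H (s + a) - H s\<bar> \<le> \<bar>a\<bar> * ((1 - cos (s - \<theta>)) + \<bar>a\<bar>)"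
    unfolding v(2) abs_mult by simp
  also have "\<dots> = (1 - cos (s - \<theta>)) * \<bar>a\<bar> + a\<^sup>2"
    by (simp add: algebra_simps power2_eq_square flip: abs_mult)
  finally show ?thesis by (simp add: H_def algebra_simps)
qed

lemma potential_bound:
  fixes a :: "nat \<Rightarrow> real"
  defines "s \<equiv> \<lambda>k. \<Sum>i<k. a i"
  assumes "0 < n" "j \<le> n" "0 < \<mu>" "1 \<le> \<mu> * real n" "0 \<le> C"
    and E: "grid_energy n a \<le> C"
    and mean: "(\<Sum>k<n. 1 - cos (s k - \<theta>)) \<le> 2 * \<mu>\<^sup>2 * real n"
  shows "\<bar>s j - sin (s j - \<theta>) - sin \<theta>\<bar> \<le> \<mu> * (2 + 3 * C)"
proof -
  define h where "h k = 1 - cos (s k - \<theta>)" for k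
  have h: "0 \<le> h k" "h k \<le> 2" for k unfolding h_def using cos_ge_minus_one[of "s k - \<theta>"] by auto
  have "\<bar>s j - sin (s j - \<theta>) - sin \<theta>\<bar> \<le> (\<Sum>k<j. h k * \<bar>a k\<bar> + (a k)\<^sup>2)"
  proof (induction j)
    case 0
    then show ?case by (simp add: s_def)
  next
    case (Suc j)
    have "s (Suc j) = s j + a j" by (simp add: s_def)
    with potential_step[of "a j" "s j" \<theta>] Suc show ?case by (simp add: h_def)
  qed
  also have "\<dots> \<le> (\<Sum>k<n. h k * \<bar>a k\<bar> + (a k)\<^sup>2)"
    using \<open>j \<le> n\<close> h by (intro sum_mono2) auto
  \<comment> \<open>The product is split with weight \<open>\<mu> * real n\<close>, using
    \<open>(h k)\<^sup>2 \<le> 2 * h k\<close>. The mean of \<open>h\<close> is of order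
    \<open>\<mu>\<^sup>2\<close> and the sum of squares of order \<open>1 / n\<close>, so both parts
    become of order \<open>\<mu>\<close>.\<close>
  also have "\<dots> \<le> (\<Sum>k<n. h k / (\<mu> * real n) + (\<mu> * real n / 2 + 1) * (a k)\<^sup>2)"
  proof (intro sum_mono)
    fix k
    define \<nu> where "\<nu> = \<mu> * real n"
    have \<nu>: "0 < \<nu>" using assms by (simp add: \<nu>_def)
    have "0 \<le> (h k - \<nu> * \<bar>a k\<bar>)\<^sup>2" by simp
    hence "2 * \<nu> * (h k * \<bar>a k\<bar>) \<le> (h k)\<^sup>2 + \<nu>\<^sup>2 * (a k)\<^sup>2"
      by (simp add: power2_eq_square algebra_simps flip: abs_mult)
    also have "(h k)\<^sup>2 \<le> 2 * h k" using mult_right_mono[OF h(2) h(1), of k k] by (simp add: power2_eq_square)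
    finally have "h k * \<bar>a k\<bar> \<le> (2 * h k + \<nu>\<^sup>2 * (a k)\<^sup>2) / (2 * \<nu>)"
      using \<nu> by (simp add: le_divide_eq mult_ac)
    also have "\<dots> = h k / \<nu> + \<nu> / 2 * (a k)\<^sup>2"
      using \<nu> by (simp add: field_simps power2_eq_square)
    finally show "h k * \<bar>a k\<bar> + (a k)\<^sup>2 \<le> h k / (\<mu> * real n) + (\<mu> * real n / 2 + 1) * (a k)\<^sup>2"
      by (simp add: \<nu>_def algebra_simps)
  qed
  also have "\<dots> = (\<Sum>k<n. h k) / (\<mu> * real n) + (\<mu> * real n / 2 + 1) * (\<Sum>k<n. (a k)\<^sup>2)"
    by (simp add: sum.distrib sum_divide_distrib sum_distrib_left)
  \<comment> \<open>The hypothesis \<open>1 \<le> \<mu> * real n\<close> absorbs the lone 1 into the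
    coefficient \<open>3 / 2\<close>.\<close>
  also have "\<dots> \<le> 2 * \<mu>\<^sup>2 * real n / (\<mu> * real n) + (3 / 2 * (\<mu> * real n)) * (\<Sum>k<n. (a k)\<^sup>2)"
    using assms unfolding h_def by (intro add_mono divide_right_mono mult_right_mono sum_nonneg) auto
  also have "\<dots> = 2 * \<mu> + 3 * \<mu> * grid_energy n a"
    using assms by (simp add: grid_energy_def power2_eq_square)
  also have "\<dots> \<le> 2 * \<mu> + 3 * \<mu> * C" using E \<open>0 < \<mu>\<close> by simp
  finally show ?thesis by (simp add: algebra_simps)
qed

lemma abs_mult_le: "\<bar>c\<bar> \<le> 1 \<Longrightarrow> \<bar>d\<bar> \<le> e \<Longrightarrow> c * d \<le> (e::real)"
  using mult_mono[of "\<bar>c\<bar>" 1 "\<bar>d\<bar>" e] abs_ge_self[of "c * d"] by (simp add: abs_mult)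

text \<open>If \<open>r \<ge> 1\<close>, the mean of \<open>cos (s k - \<theta>)\<close> is almost
  at least 1, so \<open>potential_bound\<close> confines the whole angle path to a neighbourhood of
  0 and the endpoint is near \<open>(1, 0, 0)\<close>. This treats the circle and its exterior at
  once.\<close>

lemma finite_action_imp:
  assumes fin: "finite_action (x, y, \<phi>)"
  shows "norm (x, y) < 1 \<or> (x, y, \<phi>) = (1, 0, 0)"
proof (cases "norm (x, y) < 1")
  case False
  define r where "r = norm (x, y)"
  have r: "1 \<le> r" using False by (simp add: r_def)
  have "(x / r)\<^sup>2 + (y / r)\<^sup>2 = 1"
  proof -
    have "x\<^sup>2 + y\<^sup>2 = r\<^sup>2" by (simp add: r_def norm_Pair)
    thus ?thesis using r by (simp add: power_divide flip: add_divide_distrib)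
  qed
  then obtain \<theta> where "x / r = cos \<theta>" "y / r = sin \<theta>" using sincos_total_2pi by metis
  hence xy: "x = r * cos \<theta>" "y = r * sin \<theta>" using r by (auto simp: field_simps)
  obtain C0 where C0: "\<And>d N. 0 < d \<Longrightarrow> \<exists>n\<ge>N. \<exists>a. grid_point n a \<in> ball (x, y, \<phi>) d \<and> grid_energy n a \<le> C0"
    using fin unfolding finite_action_def by metis
  define C where "C = \<bar>C0\<bar>"
  have C: "0 \<le> C" "C0 \<le> C" by (auto simp: C_def)
  define H where "H u = u - sin (u - \<theta>) - sin \<theta>" for u
  have H_mono: "H u \<le> H v" if "u \<le> v" for u v
    using abs_sin_diff_le[of "v - \<theta>" "u - \<theta>"] that by (simp add: H_def abs_le_iff)
  have H_pos: "0 < H u" if "0 < u" for u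
    using abs_sin_diff_less[of "u - \<theta>" "- \<theta>"] that by (simp add: H_def abs_less_iff)
  have H_neg: "H u < 0" if "u < 0" for u
    using abs_sin_diff_less[of "u - \<theta>" "- \<theta>"] that by (simp add: H_def abs_less_iff)
  have close: "\<bar>x - 1\<bar> \<le> 2 * \<eta> \<and> \<bar>y\<bar> \<le> 2 * \<eta> \<and> \<bar>\<phi>\<bar> \<le> 2 * \<eta>" if \<eta>: "0 < \<eta>" for \<eta>
  proof -
    \<comment> \<open>As \<open>H\<close> is monotone, \<open>\<bar>H u\<bar> < \<kappa>\<close>
      forces \<open>\<bar>u\<bar> < \<eta>\<close>.\<close>
    define \<kappa> where "\<kappa> = min (H \<eta>) (- H (- \<eta>))"
    have \<kappa>: "0 < \<kappa>" using H_pos[of \<eta>] H_neg[of "- \<eta>"] \<eta> by (simp add: \<kappa>_def)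
    define \<mu> where "\<mu> = \<kappa> / (2 * (2 + 3 * C))"
    have \<mu>: "0 < \<mu>" "\<mu> * (2 + 3 * C) < \<kappa>" using \<kappa> C by (auto simp: \<mu>_def field_simps add_pos_nonneg)
    obtain N :: nat where N: "1 / \<mu> < real N" using reals_Archimedean2 by blast
    \<comment> \<open>Radius \<open>\<mu>\<^sup>2\<close> because the two planar errors add up to
      the \<open>2 * \<mu>\<^sup>2\<close> allowed in \<open>potential_bound\<close>; radius
      \<open>\<eta>\<close> for the final comparison.\<close>
    obtain n a where n: "max 1 N \<le> n"
      and a: "grid_point n a \<in> ball (x, y, \<phi>) (min (\<mu>\<^sup>2) \<eta>)" "grid_energy n a \<le> C0"
      using C0[of "min (\<mu>\<^sup>2) \<eta>" "max 1 N"] \<mu> \<eta> by auto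
    have n0: "0 < n" using n by simp
    have "1 / \<mu> \<le> real n" using N n by linarith
    hence \<mu>n: "1 \<le> \<mu> * real n" using \<mu> by (simp add: divide_le_eq mult.commute)
    define s where "s k = (\<Sum>i<k. a i)" for k
    define X Y where "X = 1 / real n * (\<Sum>k<n. cos (s k))" and "Y = 1 / real n * (\<Sum>k<n. sin (s k))"
    have gp: "grid_point n a = (X, Y, s n)" by (simp add: grid_point_def X_def Y_def s_def)
    have near: "\<bar>x - X\<bar> < min (\<mu>\<^sup>2) \<eta>" "\<bar>y - Y\<bar> < min (\<mu>\<^sup>2) \<eta>" "\<bar>\<phi> - s n\<bar> < min (\<mu>\<^sup>2) \<eta>"
      using a(1) dist_R3_ge[where x = x and x' = X and y = y and y' = Y and z = \<phi> and z' = "s n"] unfolding gp by auto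
    have "r * ((cos \<theta>)\<^sup>2 + (sin \<theta>)\<^sup>2) = cos \<theta> * x + sin \<theta> * y"
      unfolding xy by (simp only: power2_eq_square distrib_left mult_ac)
    hence "r = cos \<theta> * x + sin \<theta> * y" by simp
    also have "\<dots> = cos \<theta> * X + sin \<theta> * Y + (cos \<theta> * (x - X) + sin \<theta> * (y - Y))"
      by (simp add: algebra_simps)
    also have "cos \<theta> * (x - X) \<le> \<mu>\<^sup>2"
      using near by (intro abs_mult_le abs_cos_le_one) simp
    also have "sin \<theta> * (y - Y) \<le> \<mu>\<^sup>2"
      using near by (intro abs_mult_le abs_sin_le_one) simp
    finally have "1 - 2 * \<mu>\<^sup>2 \<le> cos \<theta> * X + sin \<theta> * Y" using r by simp
    also have "\<dots> = (\<Sum>k<n. cos (s k - \<theta>)) / real n"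
      by (simp add: sum_cos_shift X_def Y_def add_divide_distrib)
    finally have "(1 - 2 * \<mu>\<^sup>2) * real n \<le> (\<Sum>k<n. cos (s k - \<theta>))"
      using n0 by (simp add: le_divide_eq)
    hence mean: "(\<Sum>k<n. 1 - cos (s k - \<theta>)) \<le> 2 * \<mu>\<^sup>2 * real n"
      by (simp add: sum_subtractf algebra_simps)
    have small: "\<bar>s j\<bar> < \<eta>" if "j \<le> n" for j
    proof -
      have "\<bar>H (s j)\<bar> < \<kappa>"
        using potential_bound[OF n0 that \<mu>(1) \<mu>n C(1) order.trans[OF a(2) C(2)], of \<theta>] mean \<mu>
        by (simp add: s_def H_def)
      thus ?thesis using H_mono[of \<eta> "s j"] H_mono[of "s j" "- \<eta>"]
        by (fastforce simp: \<kappa>_def abs_less_iff not_less)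
    qed
    have "\<bar>X - 1\<bar> = \<bar>\<Sum>k<n. cos (s k) - cos 0\<bar> / real n"
      using n0 by (simp add: X_def sum_subtractf field_simps)
    also have "\<dots> \<le> (\<Sum>k<n. \<eta>) / real n"
      by (intro divide_right_mono order.trans[OF sum_abs] sum_mono order.trans[OF abs_cos_diff_le])
        (auto intro!: less_imp_le small)
    finally have X: "\<bar>X - 1\<bar> \<le> \<eta>" using n0 by simp
    have "\<bar>Y\<bar> = \<bar>\<Sum>k<n. sin (s k) - sin 0\<bar> / real n"
      by (simp add: Y_def)
    also have "\<dots> \<le> (\<Sum>k<n. \<eta>) / real n"
      by (intro divide_right_mono order.trans[OF sum_abs] sum_mono order.trans[OF abs_sin_diff_le])
        (auto intro!: less_imp_le small)
    finally have Y: "\<bar>Y\<bar> \<le> \<eta>" using n0 by simp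
    have "\<bar>x - X\<bar> < \<eta>" "\<bar>y - Y\<bar> < \<eta>" "\<bar>\<phi> - s n\<bar> < \<eta>" using near by auto
    thus ?thesis using X Y small[OF order_refl] by (intro conjI) linarith+
  qed
  have zero: "u = 0" if "\<And>\<eta>. 0 < \<eta> \<Longrightarrow> \<bar>u\<bar> \<le> 2 * \<eta>" for u :: real
    using that[of "\<bar>u\<bar> / 4"] by (cases "u = 0") auto
  have "x - 1 = 0" "y = 0" "\<phi> = 0" using close by (auto intro!: zero simp del: right_minus_eq)
  thus ?thesis by simp
qed simp

section \<open>Lipschitz steering to every point of the open disc\<close>

definition steers :: "real \<Rightarrow> real \<Rightarrow> real \<Rightarrow> complex \<Rightarrow> bool" where
  "steers T \<alpha> \<beta> z \<longleftrightarrow> 0 \<le> T \<and> (\<exists>f L. f 0 = \<alpha> \<and> f T = \<beta> \<and> L-lipschitz_on {0..T} f \<and>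
    ((\<lambda>s. cis (f s)) has_integral z) {0..T})"

lemma steers_concat:
  assumes "steers T \<alpha> \<beta> z" "steers T' \<beta> \<gamma> z'"
  shows "steers (T + T') \<alpha> \<gamma> (z + z')"
proof -
  obtain f L where f: "f 0 = \<alpha>" "f T = \<beta>" "L-lipschitz_on {0..T} f"
    "((\<lambda>s. cis (f s)) has_integral z) {0..T}" "0 \<le> T" using assms by (auto simp: steers_def)
  obtain g L' where g: "g 0 = \<beta>" "g T' = \<gamma>" "L'-lipschitz_on {0..T'} g"
    "((\<lambda>s. cis (g s)) has_integral z') {0..T'}" "0 \<le> T'" using assms by (auto simp: steers_def)
  define h where "h s = (if s \<le> T then f s else g (s - T))" for s
  have "(max L L')-lipschitz_on {T..T + T'} (\<lambda>s. g (s - T))"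
  proof (rule lipschitz_onI)
    fix s s' assume "s \<in> {T..T + T'}" "s' \<in> {T..T + T'}"
    hence "dist (g (s - T)) (g (s' - T)) \<le> L' * dist (s - T) (s' - T)"
      by (intro lipschitz_onD[OF g(3)]) auto
    also have "\<dots> \<le> max L L' * dist s s'" by (auto simp: dist_real_def intro!: mult_right_mono)
    finally show "dist (g (s - T)) (g (s' - T)) \<le> max L L' * dist s s'" .
  qed (use lipschitz_on_nonneg[OF f(3)] in auto)
  moreover have "(max L L')-lipschitz_on {0..T} f" by (rule lipschitz_on_le[OF f(3)]) simp
  ultimately have lip: "(max L L')-lipschitz_on {0..T + T'} h"
    unfolding h_def using f g by (intro lipschitz_on_concat) auto
  have 1: "((\<lambda>s. cis (h s)) has_integral z) {0..T}"
    by (rule has_integral_eq[OF _ f(4)]) (simp add: h_def)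
  have "((\<lambda>s. cis (g (s - T))) has_integral z') {T..T + T'}"
    using has_integral_shift_real_ivl[of "\<lambda>s. cis (g s)" z' 0 T' "- T"] g by (simp add: add.commute)
  hence 2: "((\<lambda>s. cis (h s)) has_integral z') {T..T + T'}"
    by (rule has_integral_eq[rotated]) (use f g in \<open>auto simp: h_def\<close>)
  have "((\<lambda>s. cis (h s)) has_integral z + z') {0..T + T'}"
    using f(5) g(5) by (intro has_integral_combine[OF _ _ 1 2]) auto
  moreover have "h 0 = \<alpha>" "h (T + T') = \<gamma>" using f g by (auto simp: h_def)
  ultimately show ?thesis unfolding steers_def using lip f(5) g(5)
    by (intro conjI exI[of _ h] exI[of _ "max L L'"]) auto
qed

lemma steers_stay: "0 \<le> T \<Longrightarrow> steers T \<alpha> \<alpha> (of_real T * cis \<alpha>)"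
  unfolding steers_def
  using has_integral_const_real[of "cis \<alpha>" 0 T]
  by (intro conjI exI[of _ "\<lambda>_. \<alpha>"] exI[of _ 0])
    (auto simp: scaleR_conv_of_real intro: lipschitz_onI)

lemma steers_linear:
  assumes "0 \<le> T" "((\<lambda>s. cis (\<alpha> + v * s)) has_integral z) {0..T}"
  shows "steers T \<alpha> (\<alpha> + v * T) z"
  unfolding steers_def
  using assms by (intro conjI exI[of _ "\<lambda>s. \<alpha> + v * s"] exI[of _ "\<bar>v\<bar>"])
   (auto intro!: lipschitz_onI simp: dist_real_def abs_mult simp flip: right_diff_distrib)

text \<open>Complex displacements pay off here: rotation at constant speed has an explicit
  antiderivative.\<close>

lemma steers_rotate:
  assumes "0 \<le> T" "v \<noteq> 0"
  shows "steers T \<alpha> (\<alpha> + v * T) ((cis (\<alpha> + v * T) - cis \<alpha>) / (\<i> * of_real v))"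
proof (rule steers_linear[OF assms(1)])
  have "((\<lambda>s. cis (\<alpha> + v * s) / (\<i> * of_real v)) has_vector_derivative cis (\<alpha> + v * s)) (at s within {0..T})" for s
    using assms
    by (auto intro!: derivative_eq_intros simp: has_vector_derivative_def scaleR_conv_of_real field_simps)
  from fundamental_theorem_of_calculus[OF assms(1) this]
  show "((\<lambda>s. cis (\<alpha> + v * s)) has_integral (cis (\<alpha> + v * T) - cis \<alpha>) / (\<i> * of_real v)) {0..T}"
    by (simp add: diff_divide_distrib)
qed

text \<open>A full turn at constant speed integrates to \<open>0\<close>, so only the stop on the way contributes.\<close>

lemma steers_turn:
  assumes "0 < e" "0 \<le> \<tau>" "0 \<le> \<psi>" "\<psi> \<le> 2 * pi"
  shows "steers (e + \<tau>) \<alpha> (\<alpha> + 2 * pi) (of_real \<tau> * cis (\<alpha> + \<psi>))"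
proof -
  define v where "v = 2 * pi / e"
  have v: "0 < v" using assms by (simp add: v_def)
  \<comment> \<open>The arcs before and after the stop have opposite displacements, since the turn
    ends at its initial direction.\<close>
  have 1: "steers (\<psi> / v) \<alpha> (\<alpha> + \<psi>) ((cis (\<alpha> + \<psi>) - cis \<alpha>) / (\<i> * of_real v))"
    using steers_rotate[of "\<psi> / v" v \<alpha>] v assms by simp
  have "cis (\<alpha> + 2 * pi) = cis \<alpha>" by (simp flip: cis_mult)
  hence 2: "steers ((2 * pi - \<psi>) / v) (\<alpha> + \<psi>) (\<alpha> + 2 * pi) ((cis \<alpha> - cis (\<alpha> + \<psi>)) / (\<i> * of_real v))"
    using steers_rotate[of "(2 * pi - \<psi>) / v" v "\<alpha> + \<psi>"] v assms
    by simp
  have "\<psi> / v + \<tau> + (2 * pi - \<psi>) / v = e + \<tau>"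
    using assms by (simp add: v_def field_simps)
  thus ?thesis
    using steers_concat[OF steers_concat[OF 1 steers_stay[OF assms(2), of "\<alpha> + \<psi>"]] 2]
    by (simp add: diff_divide_distrib add_ac)
qed

text \<open>Supplies a short last leg that corrects the angle; its displacement is known only to be
  small.\<close>

lemma ex_steers:
  assumes "0 < T"
  shows "\<exists>w. norm w \<le> T \<and> steers T \<alpha> \<beta> w"
proof -
  define v where "v = (\<beta> - \<alpha>) / T"
  have "(\<lambda>s. cis (\<alpha> + v * s)) integrable_on {0..T}"
    by (intro integrable_continuous_real continuous_intros)
  then obtain w where w: "((\<lambda>s. cis (\<alpha> + v * s)) has_integral w) {0..T}" by blast
  have "norm w \<le> T" using has_integral_bound_real[OF _ _ w, of 1 "{}"] assms by simp
  moreover have "steers T \<alpha> \<beta> w" using steers_linear[OF _ w] assms by (simp add: v_def)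
  ultimately show ?thesis by blast
qed

text \<open>The speed is always 1, so surplus time must be wasted: the stops point along
  \<open>u\<close> and \<open>- u\<close>, their durations have difference \<open>\<rho>\<close> and
  sum \<open>1 - 3 * e\<close>. The last leg from \<open>4 * pi\<close> to \<open>\<beta>\<close> is
  fixed beforehand, and its displacement \<open>w\<close> is subtracted from the target.\<close>

lemma steers_unit_time:
  assumes "norm z < 1"
  shows "steers 1 0 \<beta> z"
proof -
  define e where "e = (1 - norm z) / 8"
  have e: "0 < e" using assms by (simp add: e_def)
  obtain w where w: "norm w \<le> e" "steers e (4 * pi) \<beta> w" using ex_steers[OF e] by blast
  define \<rho> where "\<rho> = norm (z - w)"
  \<comment> \<open>From \<open>norm w \<le> e\<close> follows
    \<open>\<rho> \<le> 1 - 7 * e\<close>, well within the \<open>1 - 3 * e\<close> left by two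
    turns and the last leg.\<close>
  have "8 * e = 1 - norm z" by (simp add: e_def)
  hence \<rho>: "\<rho> \<le> 1 - 3 * e" using norm_triangle_ineq4[of z w] w e unfolding \<rho>_def by linarith
  \<comment> \<open>\<open>sgn 0\<close> is not a unit vector; for \<open>z = w\<close> any
    direction will do.\<close>
  define u where "u = (if z = w then 1 else sgn (z - w))"
  have u: "norm u = 1" "z - w = of_real \<rho> * u"
    by (auto simp: u_def \<rho>_def norm_sgn) (simp add: sgn_eq)
  have ex: "\<exists>\<psi>. 0 \<le> \<psi> \<and> \<psi> \<le> 2 * pi \<and> cis \<psi> = u" if "norm u = 1" for u
  proof -
    have "(Re u)\<^sup>2 + (Im u)\<^sup>2 = 1" using that by (simp add: cmod_def)
    then obtain \<psi> where "0 \<le> \<psi>" "\<psi> < 2 * pi" "Re u = cos \<psi>" "Im u = sin \<psi>"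
      using sincos_total_2pi by metis
    thus ?thesis by (intro exI[of _ \<psi>]) (auto simp: complex_eq_iff)
  qed
  obtain \<psi> where \<psi>: "0 \<le> \<psi>" "\<psi> \<le> 2 * pi" "cis \<psi> = u" using ex u by blast
  obtain \<psi>' where \<psi>': "0 \<le> \<psi>'" "\<psi>' \<le> 2 * pi" "cis \<psi>' = - u" using ex[of "- u"] u by auto
  define \<tau> \<tau>' where "\<tau> = (1 - 3 * e + \<rho>) / 2" and "\<tau>' = (1 - 3 * e - \<rho>) / 2"
  have \<tau>: "0 \<le> \<tau>" "0 \<le> \<tau>'" using \<rho> norm_ge_zero[of "z - w", folded \<rho>_def] by (auto simp: \<tau>_def \<tau>'_def)
  have 1: "steers (e + \<tau>) 0 (2 * pi) (of_real \<tau> * u)"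
    using steers_turn[OF e \<tau>(1) \<psi>(1,2), of 0] \<psi>(3) by simp
  have 2: "steers (e + \<tau>') (2 * pi) (4 * pi) (of_real \<tau>' * - u)"
    using steers_turn[OF e \<tau>(2) \<psi>'(1,2), of "2 * pi"] \<psi>'(3) by (simp flip: cis_mult)
  have time: "e + \<tau> + (e + \<tau>') + e = 1" by (simp add: \<tau>_def \<tau>'_def field_simps)
  have "of_real \<tau> * u + of_real \<tau>' * - u = of_real (\<tau> - \<tau>') * u" by (simp add: algebra_simps)
  also have "\<tau> - \<tau>' = \<rho>" by (simp add: \<tau>_def \<tau>'_def field_simps)
  finally have "of_real \<tau> * u + of_real \<tau>' * - u + w = z" by (simp only: flip: u(2)) simp
  with steers_concat[OF steers_concat[OF 1 2] w(2)] time show ?thesis by simp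
qed

text \<open>A Lipschitz bound controls each of the \<open>n\<close> increments by
  \<open>L / n\<close>, so the energy is at most \<open>L\<^sup>2 / 2\<close> on every grid, while
  the two Riemann errors of \<open>L / n\<close> vanish.\<close>

lemma steers_imp_finite_action:
  assumes "steers 1 0 \<phi> z"
  shows "finite_action (Re z, Im z, \<phi>)"
proof -
  obtain f :: "real \<Rightarrow> real" and L where f: "f 0 = 0" "f 1 = \<phi>" and lip: "L-lipschitz_on {0..1} f"
    and int: "((\<lambda>s. cis (f s)) has_integral z) {0..1}" using assms by (auto simp: steers_def)
  have L: "0 \<le> L" by (rule lipschitz_on_nonneg[OF lip])
  have x: "((\<lambda>s. cos (f s)) has_integral Re z) {0..1}"
    using has_integral_linear[OF int bounded_linear_Re] by (simp add: o_def)
  have y: "((\<lambda>s. sin (f s)) has_integral Im z) {0..1}"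
    using has_integral_linear[OF int bounded_linear_Im] by (simp add: o_def)
  show ?thesis
    unfolding finite_action_def
  proof (intro exI[of _ "L\<^sup>2 / 2"] allI impI)
    fix d :: real and N :: nat assume d: "0 < d"
    obtain k :: nat where k: "2 * L / d < real k" using reals_Archimedean2 by blast
    define n where "n = Suc (max N k)"
    have n: "0 < n" "N \<le> n" by (auto simp: n_def)
    have "2 * L / d < real n" using k by (simp add: n_def)
    hence Ln: "2 * (L / real n) < d" using d n by (simp add: field_simps)
    define a where "a i = f (real (Suc i) / real n) - f (real i / real n)" for i
    have S: "(\<Sum>i<k. a i) = f (real k / real n)" for k
      unfolding a_def using sum_lessThan_telescope[of "\<lambda>i. f (real i / real n)" k] f by simp
    have mod: "\<bar>f s - f s'\<bar> \<le> L / real n" if "s \<in> {0..1}" "s' \<in> {0..1}" "\<bar>s - s'\<bar> \<le> 1 / real n" for s s'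
      using lipschitz_onD[OF lip that(1,2)] mult_left_mono[OF that(3) L] by (simp add: dist_real_def)
    have "\<bar>Re z / 1 - 1 / real n * (\<Sum>k<n. cos (f (1 * real k / real n)))\<bar> \<le> L / real n"
      using n L by (intro riemann_sum_error[OF x]) (auto intro!: order.trans[OF abs_cos_diff_le] mod)
    moreover have "\<bar>Im z / 1 - 1 / real n * (\<Sum>k<n. sin (f (1 * real k / real n)))\<bar> \<le> L / real n"
      using n L by (intro riemann_sum_error[OF y]) (auto intro!: order.trans[OF abs_sin_diff_le] mod)
    ultimately have "dist (Re z, Im z, \<phi>) (grid_point n a) \<le> L / real n + L / real n + 0"
      unfolding grid_point_def S
      using n f by (intro order.trans[OF dist_R3_le] add_mono) auto
    hence "grid_point n a \<in> ball (Re z, Im z, \<phi>) d" using Ln by simp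
    moreover have "grid_energy n a \<le> L\<^sup>2 / 2"
    proof -
      have "(a i)\<^sup>2 \<le> (L / real n)\<^sup>2" if "i < n" for i
      proof -
        have "\<bar>a i\<bar> \<le> L / real n"
          unfolding a_def using that n
          by (intro mod) (auto simp: field_simps)
        thus ?thesis by (metis abs_ge_zero power2_abs power_mono)
      qed
      hence "grid_energy n a \<le> real n / 2 * (\<Sum>i<n. (L / real n)\<^sup>2)"
        unfolding grid_energy_def by (intro mult_left_mono sum_mono) auto
      also have "\<dots> = L\<^sup>2 / 2" using n by (simp add: power2_eq_square)
      finally show ?thesis .
    qed
    ultimately show "\<exists>n\<ge>N. \<exists>a. grid_point n a \<in> ball (Re z, Im z, \<phi>) d \<and> grid_energy n a \<le> L\<^sup>2 / 2"
      using n by blast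
  qed
qed

lemma finite_action_iff: "finite_action (x, y, \<phi>) \<longleftrightarrow> norm (x, y) < 1 \<or> (x, y, \<phi>) = (1, 0, 0)"
proof
  assume "norm (x, y) < 1 \<or> (x, y, \<phi>) = (1, 0, 0)"
  thus "finite_action (x, y, \<phi>)"
  proof
    assume "norm (x, y) < 1"
    hence "norm (Complex x y) < 1" by (simp add: cmod_def norm_Pair)
    from steers_imp_finite_action[OF steers_unit_time[OF this]] show ?thesis by simp
  next
    assume "(x, y, \<phi>) = (1, 0, 0)"
    thus ?thesis using steers_imp_finite_action[OF steers_stay[of 1 0]] by simp
  qed
qed (rule finite_action_imp)

section \<open>The two principles\<close>

definition macro_rate :: "R3 \<Rightarrow> ennreal" where
  "macro_rate = (\<lambda>(x, y, \<phi>). if (x, y) = (0, 0) then ennreal (\<bar>\<phi>\<bar>\<^sup>2 / 2) else \<infinity>)"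

context sde_solution
begin

text \<open>Common to both scales: planar coordinates bounded by 1 and a Gaussian angle give
  tightness, so only the estimates on balls remain.\<close>

lemma large_deviation_principle_scaled:
  assumes u: "\<And>t. 0 < t \<Longrightarrow> u t = distr M borel (p t)"
    and sc: "\<And>t. 0 < t \<Longrightarrow> sc t \<in> borel_measurable borel"
    and upper: "\<And>q c. 0 \<le> c \<Longrightarrow> ennreal c < I q \<Longrightarrow>
      \<exists>d>0. exp_upper (\<lambda>t. prob {\<omega> \<in> space M. sc t (p t \<omega>) \<in> ball q d}) c"
    and lower: "\<And>q c d. 0 < d \<Longrightarrow> 0 \<le> c \<Longrightarrow> I q < ennreal c \<Longrightarrow>
      exp_lower (\<lambda>t. prob {\<omega> \<in> space M. sc t (p t \<omega>) \<in> ball q d}) c"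
    and bound: "\<forall>\<^sub>F t in at_right 0. AE \<omega> in M. \<bar>fst (sc t (p t \<omega>))\<bar> \<le> 1 \<and>
      \<bar>fst (snd (sc t (p t \<omega>)))\<bar> \<le> 1 \<and> snd (snd (sc t (p t \<omega>))) = W t \<omega> - W 0 \<omega>"
  shows "large_deviation_principle u sc I"
proof -
  let ?\<nu> = "\<lambda>t. distr M borel (\<lambda>\<omega>. sc t (p t \<omega>))"
  have X: "(\<lambda>\<omega>. sc t (p t \<omega>)) \<in> borel_measurable M" if "0 < t" for t
    using that by (intro measurable_compose[OF random_variable_p sc]) auto
  have eq: "measure (?\<nu> t) A = prob {\<omega> \<in> space M. sc t (p t \<omega>) \<in> A}"
    if "0 < t" "A \<in> sets borel" for t A
    using that by (subst measure_distr) (auto intro!: arg_cong[where f = prob] X)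
  have ev: "\<forall>\<^sub>F t in at_right 0. prob {\<omega> \<in> space M. sc t (p t \<omega>) \<in> A} = measure (?\<nu> t) A"
    if "A \<in> sets borel" for A
    using eventually_at_right_0_pos by eventually_elim (simp add: eq that)
  have up: "exp_upper (\<lambda>t. measure (?\<nu> t) A) c"
    if "exp_upper (\<lambda>t. prob {\<omega> \<in> space M. sc t (p t \<omega>) \<in> A}) c" "A \<in> sets borel" for A c
    using ev[OF that(2)] by (intro exp_upper_mono[OF that(1)]) (auto elim: eventually_mono)
  have lo: "exp_lower (\<lambda>t. measure (?\<nu> t) A) c"
    if "exp_lower (\<lambda>t. prob {\<omega> \<in> space M. sc t (p t \<omega>) \<in> A}) c" "A \<in> sets borel" for A c
    using ev[OF that(2)] by (intro exp_lower_mono[OF that(1)]) (auto elim: eventually_mono)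
  show ?thesis
  proof (rule large_deviation_principleI[where \<nu> = ?\<nu>])
    show "prob_space (?\<nu> t)" if "0 < t" for t
      using that by (intro prob_space_distr X)
    show "measure (u t) (sc t -` A) = measure (?\<nu> t) A" if t: "0 < t" and A: "A \<in> sets borel" for t A
    proof -
      have "measure (u t) (sc t -` A) = prob (p t -` (sc t -` A) \<inter> space M)"
        using t measurable_sets[OF sc[OF t] A] unfolding u[OF t]
        by (intro measure_distr random_variable_p) auto
      also have "p t -` (sc t -` A) \<inter> space M = {\<omega> \<in> space M. sc t (p t \<omega>) \<in> A}"
        by auto
      finally show ?thesis using eq[OF t A] by simp
    qed
    show "\<exists>d>0. exp_upper (\<lambda>t. measure (?\<nu> t) (ball q d)) c" if "0 \<le> c" "ennreal c < I q" for q c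
      using upper[OF that] up by auto
    show "exp_lower (\<lambda>t. measure (?\<nu> t) (ball q d)) c" if "0 < d" "0 \<le> c" "I q < ennreal c" for q c d
      using lower[OF that] lo by auto
    show "\<exists>K. compact K \<and> exp_upper (\<lambda>t. measure (?\<nu> t) (- K)) c" for c
    proof -
      obtain K where "compact K" "exp_upper (\<lambda>t. prob {\<omega> \<in> space M. sc t (p t \<omega>) \<in> - K}) c"
        using exponentially_tight[OF bound] by blast
      thus ?thesis using up[of "- K" c] by (auto simp: compact_imp_closed borel_comp)
    qed
  qed simp
qed

lemma large_deviation_principle_meso:
  assumes "\<And>t. 0 < t \<Longrightarrow> u t = distr M borel (p t)"
  shows "large_deviation_principle u mesoscopic_scale meso_rate"
proof (rule large_deviation_principle_scaled[OF assms])
  show "mesoscopic_scale t \<in> borel_measurable borel" for t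
    unfolding mesoscopic_scale_def case_prod_unfold divide_inverse
    by (intro borel_measurable_continuous_onI continuous_intros)
  show "\<forall>\<^sub>F t in at_right 0. AE \<omega> in M. \<bar>fst (mesoscopic_scale t (p t \<omega>))\<bar> \<le> 1 \<and>
      \<bar>fst (snd (mesoscopic_scale t (p t \<omega>)))\<bar> \<le> 1 \<and>
      snd (snd (mesoscopic_scale t (p t \<omega>))) = W t \<omega> - W 0 \<omega>"
    using eventually_at_right_0_pos
  proof eventually_elim
    case (elim t)
    show ?case using solution_AE[OF elim]
      by eventually_elim (use elim in \<open>auto simp: meso_eq[unfolded meso_def] divide_le_eq\<close>)
  qed
  show "\<exists>d>0. exp_upper (\<lambda>t. prob {\<omega> \<in> space M. mesoscopic_scale t (p t \<omega>) \<in> ball q d}) c"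
    if "0 \<le> c" "ennreal c < meso_rate q" for q c
    using meso_rate_upper[OF that] by (simp only: meso_def)
  show "exp_lower (\<lambda>t. prob {\<omega> \<in> space M. mesoscopic_scale t (p t \<omega>) \<in> ball q d}) c"
    if "0 < d" "0 \<le> c" "meso_rate q < ennreal c" for q c d
    using meso_rate_lower[OF that] by (simp only: meso_def)
qed

text \<open>Off the axis the event is null once \<open>t\<close> is small, which gives every
  exponent at once; on the axis it is a Gaussian tail.\<close>

lemma macro_rate_upper:
  assumes "0 \<le> c" "ennreal c < macro_rate q"
  shows "\<exists>d>0. exp_upper (\<lambda>t. prob {\<omega> \<in> space M. p t \<omega> \<in> ball q d}) c"
proof -
  obtain x y \<phi> where q: "q = (x, y, \<phi>)" by (cases q) auto
  show ?thesis
  proof (cases "(x, y) = (0, 0)")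
    case False
    \<comment> \<open>\<open>\<bar>x\<bar>\<close> or \<open>\<bar>y\<bar>\<close> is at least
      \<open>r\<close>, while the solution stays within \<open>t < r / 2\<close> of the axis in both
      coordinates.\<close>
    define r where "r = (\<bar>x\<bar> + \<bar>y\<bar>) / 2"
    have r: "0 < r" using False by (auto simp: r_def)
    have "exp_upper (\<lambda>t. prob {\<omega> \<in> space M. p t \<omega> \<in> ball q (r / 2)}) c"
      unfolding exp_upper_def
      using eventually_at_right_0_less[OF half_gt_zero[OF r]]
    proof eventually_elim
      case (elim t)
      have t: "0 < t" "t < r / 2" using elim by auto
      have "prob {\<omega> \<in> space M. p t \<omega> \<in> ball q (r / 2)} \<le> prob {}"
      proof (rule finite_measure_mono_AE)
        show "AE \<omega> in M. \<omega> \<in> {\<omega> \<in> space M. p t \<omega> \<in> ball q (r / 2)} \<longrightarrow> \<omega> \<in> {}"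
          using solution_AE[OF t(1)]
        proof eventually_elim
          case (elim \<omega>)
          obtain x' y' z' where p: "p t \<omega> = (x', y', z')" by (cases "p t \<omega>") auto
          have "\<bar>x - x'\<bar> \<le> dist q (p t \<omega>)" "\<bar>y - y'\<bar> \<le> dist q (p t \<omega>)"
            unfolding p q by (rule dist_R3_ge)+
          moreover have "\<bar>x'\<bar> \<le> t" "\<bar>y'\<bar> \<le> t" using elim p by auto
          moreover have "\<bar>x\<bar> + \<bar>y\<bar> = 2 * r" by (simp add: r_def)
          ultimately have "r / 2 \<le> dist q (p t \<omega>)" using t by linarith
          thus ?case by simp
        qed
      qed simp
      hence "prob {\<omega> \<in> space M. p t \<omega> \<in> ball q (r / 2)} \<le> 0" by simp
      also have "0 \<le> exp (- c / t)" by simp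
      finally show ?case .
    qed
    thus ?thesis using r by (intro exI[of _ "r / 2"]) auto
  next
    case True
    hence c: "c < \<phi>\<^sup>2 / 2" using assms by (simp add: q macro_rate_def ennreal_less_iff)
    define s where "s = sqrt (2 * c)"
    have s: "0 \<le> s" "s\<^sup>2 = 2 * c" using assms by (auto simp: s_def)
    have "s\<^sup>2 < \<bar>\<phi>\<bar>\<^sup>2" using c s by simp
    hence lt: "s < \<bar>\<phi>\<bar>" by (rule power2_less_imp_less) simp
    \<comment> \<open>Half the gap between \<open>\<bar>\<phi>\<bar>\<close> and
      \<open>sqrt (2 * c)\<close>, so that angles within \<open>d\<close> of \<open>\<phi>\<close>
      still cost more than \<open>c\<close>.\<close>
    define d where "d = (\<bar>\<phi>\<bar> - s) / 2"
    have d: "0 < d" "s < \<bar>\<phi>\<bar> - d" using lt by (auto simp: d_def field_simps)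
    define m where "m = (\<bar>\<phi>\<bar> - d)\<^sup>2 / 2"
    have "s\<^sup>2 < (\<bar>\<phi>\<bar> - d)\<^sup>2" using s d by (intro power_strict_mono) auto
    hence m: "c < m" using s by (simp add: m_def)
    have "exp_upper (\<lambda>t. prob {\<omega> \<in> space M. m \<le> real 1 / 2 * (\<Sum>i<1. (increment t 1 i \<omega>)\<^sup>2)}) c"
      using m by (intro exp_upper_energy) auto
    hence "exp_upper (\<lambda>t. prob {\<omega> \<in> space M. p t \<omega> \<in> ball q d}) c"
    proof (rule exp_upper_mono)
      show "\<forall>\<^sub>F t in at_right 0. prob {\<omega> \<in> space M. p t \<omega> \<in> ball q d} \<le>
        prob {\<omega> \<in> space M. m \<le> real 1 / 2 * (\<Sum>i<1. (increment t 1 i \<omega>)\<^sup>2)}"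
        using eventually_at_right_0_pos
      proof eventually_elim
        case (elim t)
        show ?case
        proof (rule finite_measure_mono_AE)
          show "AE \<omega> in M. \<omega> \<in> {\<omega> \<in> space M. p t \<omega> \<in> ball q d} \<longrightarrow>
            \<omega> \<in> {\<omega> \<in> space M. m \<le> real 1 / 2 * (\<Sum>i<1. (increment t 1 i \<omega>)\<^sup>2)}"
            using solution_AE[OF elim]
          proof eventually_elim
            case (elim \<omega>)
            have inc: "increment t 1 0 \<omega> = snd (snd (p t \<omega>))" using elim by (simp add: increment_def)
            have "m \<le> (increment t 1 0 \<omega>)\<^sup>2 / 2" if "p t \<omega> \<in> ball q d"
            proof -
              have "\<bar>\<phi> - snd (snd (p t \<omega>))\<bar> < d"
                using that dist_R3_ge(3)[where z = \<phi> and z' = "snd (snd (p t \<omega>))" and x = x and y = y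
                    and x' = "fst (p t \<omega>)" and y' = "fst (snd (p t \<omega>))"]
                by (simp add: q)
              hence "\<bar>\<phi>\<bar> - d \<le> \<bar>increment t 1 0 \<omega>\<bar>" unfolding inc by linarith
              hence "(\<bar>\<phi>\<bar> - d)\<^sup>2 \<le> \<bar>increment t 1 0 \<omega>\<bar>\<^sup>2" using s d by (intro power_mono) auto
              thus ?thesis by (simp add: m_def)
            qed
            thus ?case by auto
          qed
          have [measurable]: "increment t 1 i \<in> borel_measurable M" for i
            using elim by (auto intro: random_variable_increment)
          show "{\<omega> \<in> space M. m \<le> real 1 / 2 * (\<Sum>i<1. (increment t 1 i \<omega>)\<^sup>2)} \<in> events"
            by measurable
        qed
      qed
    qed simp
    thus ?thesis using d by blast
  qed
qed

lemma macro_rate_lower: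
  assumes "0 < d" "0 \<le> c" "macro_rate q < ennreal c"
  shows "exp_lower (\<lambda>t. prob {\<omega> \<in> space M. p t \<omega> \<in> ball q d}) c"
proof -
  obtain x y \<phi> where q: "q = (x, y, \<phi>)" by (cases q) auto
  have xy: "x = 0" "y = 0" and c: "\<phi>\<^sup>2 / 2 < c"
    using assms by (auto simp: q macro_rate_def ennreal_less_iff split: if_splits)
  have "exp_lower (\<lambda>t. prob {\<omega> \<in> space M. \<forall>i<1. \<bar>increment t 1 i \<omega> - \<phi>\<bar> < d / 2}) c"
    using assms c by (intro exp_lower_increments) auto
  thus ?thesis
  proof (rule exp_lower_mono)
    \<comment> \<open>The radius is split as \<open>d / 4 + d / 4 + d / 2\<close> over the three
      coordinates; the planar ones are at most \<open>t\<close>.\<close>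
    have d4: "0 < d / 4" using assms by simp
    show "\<forall>\<^sub>F t in at_right 0. prob {\<omega> \<in> space M. \<forall>i<1. \<bar>increment t 1 i \<omega> - \<phi>\<bar> < d / 2} \<le>
      prob {\<omega> \<in> space M. p t \<omega> \<in> ball q d}"
      using eventually_at_right_0_less[OF d4]
    proof eventually_elim
      case (elim t)
      have t: "0 < t" "t < d / 4" using elim by auto
      show ?case
      proof (rule finite_measure_mono_AE)
        show "AE \<omega> in M. \<omega> \<in> {\<omega> \<in> space M. \<forall>i<1. \<bar>increment t 1 i \<omega> - \<phi>\<bar> < d / 2} \<longrightarrow>
          \<omega> \<in> {\<omega> \<in> space M. p t \<omega> \<in> ball q d}"
          using solution_AE[OF t(1)]
        proof eventually_elim
          case (elim \<omega>)
          obtain x' y' z' where p: "p t \<omega> = (x', y', z')" by (cases "p t \<omega>") auto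
          have inc: "increment t 1 0 \<omega> = z'" using elim p by (simp add: increment_def)
          have xy': "\<bar>x'\<bar> \<le> t" "\<bar>y'\<bar> \<le> t" using elim p by auto
          show ?case
          proof
            assume A: "\<omega> \<in> {\<omega> \<in> space M. \<forall>i<1. \<bar>increment t 1 i \<omega> - \<phi>\<bar> < d / 2}"
            hence "\<bar>\<phi> - z'\<bar> < d / 2" using inc by (auto simp: abs_minus_commute)
            moreover have "dist q (p t \<omega>) \<le> \<bar>0 - x'\<bar> + \<bar>0 - y'\<bar> + \<bar>\<phi> - z'\<bar>"
              unfolding p q xy by (rule dist_R3_le)
            ultimately have "dist q (p t \<omega>) < d" using xy' t by simp
            thus "\<omega> \<in> {\<omega> \<in> space M. p t \<omega> \<in> ball q d}" using A by simp
          qed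
        qed
        show "{\<omega> \<in> space M. p t \<omega> \<in> ball q d} \<in> events"
          using measurable_sets[OF random_variable_p, of t "ball q d"] t
          by (simp add: vimage_def Int_def conj_commute)
      qed
    qed
  qed simp
qed

lemma large_deviation_principle_macro:
  assumes "\<And>t. 0 < t \<Longrightarrow> u t = distr M borel (p t)"
  shows "large_deviation_principle u macroscopic_scale macro_rate"
proof (rule large_deviation_principle_scaled[OF assms])
  have id: "macroscopic_scale t q = q" for t q
    by (simp add: macroscopic_scale_def split: prod.split)
  show "macroscopic_scale t \<in> borel_measurable borel" for t
    by (simp add: id[abs_def])
  show "\<exists>d>0. exp_upper (\<lambda>t. prob {\<omega> \<in> space M. macroscopic_scale t (p t \<omega>) \<in> ball q d}) c"
    if "0 \<le> c" "ennreal c < macro_rate q" for q c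
    unfolding id using macro_rate_upper[OF that] .
  show "exp_lower (\<lambda>t. prob {\<omega> \<in> space M. macroscopic_scale t (p t \<omega>) \<in> ball q d}) c"
    if "0 < d" "0 \<le> c" "macro_rate q < ennreal c" for q c d
    unfolding id using macro_rate_lower[OF that] .
  show "\<forall>\<^sub>F t in at_right 0. AE \<omega> in M. \<bar>fst (macroscopic_scale t (p t \<omega>))\<bar> \<le> 1 \<and>
      \<bar>fst (snd (macroscopic_scale t (p t \<omega>)))\<bar> \<le> 1 \<and>
      snd (snd (macroscopic_scale t (p t \<omega>))) = W t \<omega> - W 0 \<omega>"
    unfolding id using eventually_at_right_0_less[OF zero_less_one]
  proof eventually_elim
    case (elim t)
    hence t: "0 < t" "t < 1" by auto
    show ?case using solution_AE[OF t(1)]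
      by eventually_elim (use t in auto)
  qed
qed

end

theorem theorem4:
  fixes M :: "'a measure"
    and W :: "real \<Rightarrow> 'a \<Rightarrow> real"
    and p :: "real \<Rightarrow> 'a \<Rightarrow> R3"
    and u :: "real \<Rightarrow> R3 measure"
  assumes "standard_brownian_motion M W"
    and "solves_sde M W p"
    and "\<And>t. 0 < t \<Longrightarrow> u t = distr M borel (p t)"
  shows "(\<exists>I_macro :: R3 \<Rightarrow> ennreal.
            large_deviation_principle u macroscopic_scale I_macro \<and>
            (\<forall>x y \<phi>. I_macro (x, y, \<phi>) =
              (if (x, y) = (0, 0) then ennreal (\<bar>\<phi>\<bar>\<^sup>2 / 2) else \<infinity>))) \<and>
         (\<exists>I_meso :: R3 \<Rightarrow> ennreal.
            large_deviation_principle u mesoscopic_scale I_meso \<and>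
            (\<forall>x y \<phi>. I_meso (x, y, \<phi>) < \<infinity> \<longleftrightarrow>
              norm (x, y) < 1 \<or> (x, y, \<phi>) = (1, 0, 0)))"
proof -
  interpret standard_brownian_motion M W by fact
  interpret sde_solution M W p by unfold_locales fact
  show ?thesis
  proof (intro conjI exI allI)
    show "large_deviation_principle u macroscopic_scale macro_rate"
      using assms(3) by (rule large_deviation_principle_macro)
    show "large_deviation_principle u mesoscopic_scale meso_rate"
      using assms(3) by (rule large_deviation_principle_meso)
    show "macro_rate (x, y, \<phi>) = (if (x, y) = (0, 0) then ennreal (\<bar>\<phi>\<bar>\<^sup>2 / 2) else \<infinity>)" for x y \<phi>
      by (simp add: macro_rate_def)
    show "meso_rate (x, y, \<phi>) < \<infinity> \<longleftrightarrow> norm (x, y) < 1 \<or> (x, y, \<phi>) = (1, 0, 0)" for x y \<phi>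
      by (simp only: meso_rate_finite_iff finite_action_iff)
  qed
qed

end
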